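(* Let $I_{SO(7)}$ and $I_{Sp(3)}$ be the indices of the letter-based truncation with letters $\{X,\bar\lambda_{\dot\alpha},D_{+\dot\alpha}\}$ (single-letter index $1-\frac{1-a}{(1-p)(1-q)}$), defined in the context, evaluated at $a=t^2$, $p=q=t^3$ and expanded as power series in $t$. Then $$\begin{aligned}I_{SO(7)}=\;&1+t^4-2t^5+t^6+2t^7-2t^8-2t^9+6t^{10}-4t^{11}-5t^{12}+10t^{13}+2t^{14}-18t^{15}\\&+15t^{16}+10t^{17}-33t^{18}+14t^{19}+40t^{20}-56t^{21}-4t^{22}+84t^{23}+\cdots,\\ I_{Sp(3)}=\;&1+t^4-2t^5+t^6+2t^7-2t^8-2t^9+6t^{10}-4t^{11}-5t^{12}+10t^{13}+2t^{14}-18t^{15}\\&+15t^{16}+10t^{17}-33t^{18}+14t^{19}+40t^{20}-56t^{21}-5t^{22}+86t^{23}+\cdots,\end{aligned}$$ where the dots denote terms of order $t^{24}$ and higher. In particular the two indices agree up to and including order $t^{21}$ and differ at order $t^{22}$.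
   Context: $\mathrm{PE}$ is the plethystic exponential, $\mathrm{PE}[g(x_1,\dots,x_k)]=\exp\left(\sum_{n\ge1}\frac1n g(x_1^n,\dots,x_k^n)\right)$, applied to all fugacities $a,p,q$ and gauge variables $z_i$ (with numerical coefficients, including signs, unchanged), and $(x;x)_\infty=\prod_{n\ge1}(1-x^n)$. Here $\left(\frac{z_i}{z_j}\right)^{\pm}$ denotes $\frac{z_i}{z_j}+\frac{z_j}{z_i}$, and similarly $(z_iz_j)^\pm=z_iz_j+\frac1{z_iz_j}$, $z_i^\pm=z_i+z_i^{-1}$, $z_i^{\pm2}=z_i^2+z_i^{-2}$. The indices are $$I_{SO(2N+1)}=\frac{(p;p)_\infty^N(q;q)_\infty^N}{2^NN!}\left(\mathrm{PE}\left[\tfrac{a-pq}{(1-p)(1-q)}\right]\right)^N\oint\prod_{i=1}^N\frac{dz_i}{2\pi iz_i}\,\mathrm{PE}\left[\tfrac{a-1}{(1-p)(1-q)}\Big(\sum_{i<j}\big((\tfrac{z_i}{z_j})^\pm+(z_iz_j)^\pm\big)+\sum_iz_i^\pm\Big)\right],$$ $$I_{Sp(N)}=\frac{(p;p)_\infty^N(q;q)_\infty^N}{2^NN!}\left(\mathrm{PE}\left[\tfrac{a-pq}{(1-p)(1-q)}\right]\right)^N\oint\prod_{i=1}^N\frac{dz_i}{2\pi iz_i}\,\mathrm{PE}\left[\tfrac{a-1}{(1-p)(1-q)}\Big(\sum_{i<j}\big((\tfrac{z_i}{z_j})^\pm+(z_iz_j)^\pm\big)+\sum_iz_i^{\pm2}\Big)\right],$$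 with $z_i$ integrated counterclockwise over unit circles; $I_{SO(7)}$ and $I_{Sp(3)}$ are the cases $N=3$. Each factor $\mathrm{PE}\left[\frac{a-1}{(1-p)(1-q)}w\right]$ with $w$ a monomial in the $z_i$ equals $\prod_{m,n\ge0}\frac{1-p^mq^nw}{1-a\,p^mq^nw}$. *)

theory Defs
  imports "HOL-Complex_Analysis.Complex_Analysis"
begin

text \<open>
  Plethystic exponential of a function \<open>g\<close> of the fugacities \<open>a, p, q\<close> and of the gauge
  variables \<open>z i\<close>.  The series is summed in its natural order: for \<open>\<bar>a\<bar>, \<bar>p\<bar>, \<bar>q\<bar> < 1\<close> and unit
  \<open>z i\<close>, the series in the integrand of the index converges only conditionally, and it converges
  unless some nonzero root takes the value 1 at \<open>z\<close>, where it diverges.  These \<open>z\<close> form a null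
  set, so the arbitrary value of PE there does not affect the index.
\<close>

definition PE ::
  "(complex \<Rightarrow> complex \<Rightarrow> complex \<Rightarrow> (nat \<Rightarrow> complex) \<Rightarrow> complex) \<Rightarrow>
    complex \<Rightarrow> complex \<Rightarrow> complex \<Rightarrow> (nat \<Rightarrow> complex) \<Rightarrow> complex" where
  "PE g a p q z =
     exp (\<Sum>n. g (a ^ Suc n) (p ^ Suc n) (q ^ Suc n) (\<lambda>i. z i ^ Suc n) / of_nat (Suc n))"

definition qpoch_inf :: "complex \<Rightarrow> complex" where
  "qpoch_inf x = (\<Prod>n. 1 - x ^ Suc n)"

text \<open>
  Iterated integral over counterclockwise unit circles of \<open>f z\<close> against the product of
  \<open>dz\<^sub>i / (2 \<pi> i z\<^sub>i)\<close> for \<open>i < N\<close>.  Coordinates with index at least \<open>N\<close> are not integrated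
  and are set to 1; the integrands below do not depend on them.
\<close>

primrec torus_integral :: "nat \<Rightarrow> ((nat \<Rightarrow> complex) \<Rightarrow> complex) \<Rightarrow> complex" where
  "torus_integral 0 f = f (\<lambda>_. 1)"
| "torus_integral (Suc N) f =
     contour_integral (circlepath 0 1)
       (\<lambda>w. torus_integral N (\<lambda>z. f (z(N := w))) / (2 * of_real pi * \<i> * w))"

text \<open>Sums of \<open>z\<close> over the nonzero roots; the gauge variables are numbered from 0.\<close>

definition roots_SO_odd :: "nat \<Rightarrow> (nat \<Rightarrow> complex) \<Rightarrow> complex" where
  "roots_SO_odd N z =
     (\<Sum>j<N. \<Sum>i<j. (z i / z j + z j / z i) + (z i * z j + 1 / (z i * z j)))
     + (\<Sum>i<N. z i + 1 / z i)"

definition roots_Sp :: "nat \<Rightarrow> (nat \<Rightarrow> complex) \<Rightarrow> complex" where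
  "roots_Sp N z =
     (\<Sum>j<N. \<Sum>i<j. (z i / z j + z j / z i) + (z i * z j + 1 / (z i * z j)))
     + (\<Sum>i<N. z i ^ 2 + 1 / z i ^ 2)"

text \<open>
  Common form of the two indices: rank \<open>N\<close>, Weyl group of order \<open>2^N * fact N\<close>, and \<open>R\<close> the sum
  over the nonzero roots.  The first PE has an argument independent of the gauge variables, so the
  value 1 passed for them is immaterial.
\<close>

definition gauge_index ::
  "nat \<Rightarrow> ((nat \<Rightarrow> complex) \<Rightarrow> complex) \<Rightarrow> complex \<Rightarrow> complex \<Rightarrow> complex \<Rightarrow> complex" where
  "gauge_index N R a p q =
     qpoch_inf p ^ N * qpoch_inf q ^ N / (2 ^ N * fact N)
     * PE (\<lambda>a p q z. (a - p * q) / ((1 - p) * (1 - q))) a p q (\<lambda>_. 1) ^ N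
     * torus_integral N (PE (\<lambda>a p q z. (a - 1) / ((1 - p) * (1 - q)) * R z) a p q)"

text \<open>\<open>index_SO_odd N\<close> is the index for the gauge group \<open>SO(2N+1)\<close>.\<close>

definition index_SO_odd :: "nat \<Rightarrow> complex \<Rightarrow> complex \<Rightarrow> complex \<Rightarrow> complex" where
  "index_SO_odd N = gauge_index N (roots_SO_odd N)"

definition index_Sp :: "nat \<Rightarrow> complex \<Rightarrow> complex \<Rightarrow> complex \<Rightarrow> complex" where
  "index_Sp N = gauge_index N (roots_Sp N)"

end

theory Submission
  imports Defs
begin

unbundle no vec_syntax

text \<open>
  With \<open>a = t\<^sup>2\<close> and \<open>p = q = t\<^sup>3\<close>, put \<open>f(t) = 1 - (1 - t\<^sup>2) / (1 - t\<^sup>3)\<^sup>2\<close> and let \<open>\<chi>\<close> be the adjoint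
  character, that is, the rank plus the sum over the nonzero roots.  The product of the prefactor and
  the integrand is \<open>1 / 48\<close> times the Weyl density times \<open>E = exp (\<Sum>n\<ge>1. f(t\<^sup>n) \<chi>(z\<^sup>n) / n)\<close>.  Writing \<open>f(t) = \<Sum>d. f\<^sub>d t\<^sup>d\<close>
  and \<open>E = \<Sum>m. P\<^sub>m(z) t\<^sup>m\<close>, logarithmic differentiation in \<open>t\<close> gives
  \<open>m P\<^sub>m = \<Sum>j d. d f\<^sub>d \<chi>(z\<^sup>j) P\<^sub>m\<^sub>-\<^sub>j\<^sub>d\<close>, which also bounds \<open>P\<^sub>m\<close> by a geometric sequence uniformly on the torus,
  so that the integral may be taken termwise.

  The Weyl density is \<open>A\<^sub>\<rho>(z) A\<^sub>\<rho>(1 / z)\<close> for the Weyl alternant \<open>A\<^sub>\<rho>\<close>.  Multiplication by \<open>\<chi>(z\<^sup>j)\<close> maps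
  \<open>A\<^sub>\<nu>\<close> to \<open>3 A\<^sub>\<nu>\<close> plus the sum of \<open>A\<^sub>\<nu>\<^sub>+\<^sub>j\<^sub>\<alpha>\<close> over the nonzero roots \<open>\<alpha>\<close>, so the recursion computes the expansion of
  \<open>A\<^sub>\<rho> P\<^sub>m\<close> in alternants; by their orthogonality the integral is the coefficient of \<open>A\<^sub>\<rho>\<close>.
\<close>

section \<open>Tables of alternants\<close>

text \<open>
  A table is a linear combination of alternants with weights \<open>a > b > c \<ge> 0\<close>: the coefficient is the
  entry with indices \<open>c\<close>, \<open>b - c - 1\<close>, \<open>a - b - 1\<close>.  The functions below are defined by constructor
  patterns, without \<open>case\<close> and \<open>if\<close>, because these are much slower under \<open>code_simp\<close>.
\<close>

datatype signed = Pos nat | Neg nat | Zer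
datatype comparison = Gt nat | Eq | Lt nat

text \<open>The numbers carried by \<open>Gt\<close> and \<open>Lt\<close> are differences minus
  one, the same offsets by which tables are indexed, so a comparison directly yields a table
  position.\<close>

fun gap :: "nat \<Rightarrow> nat \<Rightarrow> comparison" where
  "gap 0 0 = Eq"
| "gap (Suc a) 0 = Gt a"
| "gap 0 (Suc b) = Lt b"
| "gap (Suc a) (Suc b) = gap a b"

text \<open>Straightens the index \<open>-(j + 1)\<close>. The skew functions are odd under
  \<open>k \<mapsto> -(k + 1 + of_bool s)\<close>. For \<open>s = True\<close> this fixes -1, whence
  \<open>Zer\<close> and the shift by one.\<close>

fun reflect :: "bool \<Rightarrow> nat \<Rightarrow> signed" where
  "reflect False j = Neg j"
| "reflect True 0 = Zer"
| "reflect True (Suc j) = Neg j"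

fun down :: "bool \<Rightarrow> nat \<Rightarrow> nat \<Rightarrow> signed" where
  "down s a 0 = Pos a"
| "down s (Suc a) (Suc j) = down s a j"
| "down s 0 (Suc j) = reflect s j"

type_synonym table = "int list list list"

fun put1 :: "nat \<Rightarrow> int \<Rightarrow> int list \<Rightarrow> int list" where
  "put1 0 x [] = [x]"
| "put1 0 x (y # l) = (y + x) # l"
| "put1 (Suc r) x [] = 0 # put1 r x []"
| "put1 (Suc r) x (y # l) = y # put1 r x l"

fun put2 :: "nat \<Rightarrow> nat \<Rightarrow> int \<Rightarrow> int list list \<Rightarrow> int list list" where
  "put2 0 r x [] = [put1 r x []]"
| "put2 0 r x (l # t) = put1 r x l # t"
| "put2 (Suc q) r x [] = [] # put2 q r x []"
| "put2 (Suc q) r x (l # t) = l # put2 q r x t"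

fun put3 :: "nat \<Rightarrow> nat \<Rightarrow> nat \<Rightarrow> int \<Rightarrow> table \<Rightarrow> table" where
  "put3 0 q r x [] = [put2 q r x []]"
| "put3 0 q r x (t # T) = put2 q r x t # T"
| "put3 (Suc p) q r x [] = [] # put3 p q r x []"
| "put3 (Suc p) q r x (t # T) = t # put3 p q r x T"

text \<open>Reached when \<open>a = b + 1 + r\<close> and \<open>c = b + 1 + q\<close> both exceed
  \<open>b\<close>. The order \<open>a > c > b\<close> costs one transposition and hence a sign;
  \<open>c > a > b\<close> is a 3-cycle and keeps the sign; equal indices give a vanishing
  alternant.\<close>

fun sort3 :: "comparison \<Rightarrow> nat \<Rightarrow> nat \<Rightarrow> nat \<Rightarrow> int \<Rightarrow> table \<Rightarrow> table" where
  "sort3 (Gt r') b q r x T = put3 b q r' (- x) T"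
| "sort3 Eq b q r x T = T"
| "sort3 (Lt r') b q r x T = put3 b r r' x T"

fun sort2 :: "comparison \<Rightarrow> nat \<Rightarrow> nat \<Rightarrow> nat \<Rightarrow> int \<Rightarrow> table \<Rightarrow> table" where
  "sort2 (Gt q) r b c x T = put3 c q r x T"
| "sort2 Eq r b c x T = T"
| "sort2 (Lt q) r b c x T = sort3 (gap r q) b q r x T"

fun sort1 :: "comparison \<Rightarrow> nat \<Rightarrow> nat \<Rightarrow> nat \<Rightarrow> int \<Rightarrow> table \<Rightarrow> table" where
  "sort1 (Gt r) a b c x T = sort2 (gap b c) r b c x T"
| "sort1 Eq a b c x T = T"
| "sort1 (Lt r) a b c x T = sort2 (gap a c) r a c (- x) T"

fun place3 :: "nat \<Rightarrow> nat \<Rightarrow> signed \<Rightarrow> int \<Rightarrow> table \<Rightarrow> table" where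
  "place3 a b (Pos c) x T = sort1 (gap a b) a b c x T"
| "place3 a b (Neg c) x T = sort1 (gap a b) a b c (- x) T"
| "place3 a b Zer x T = T"

fun place2 :: "nat \<Rightarrow> signed \<Rightarrow> signed \<Rightarrow> int \<Rightarrow> table \<Rightarrow> table" where
  "place2 a (Pos b) C x T = place3 a b C x T"
| "place2 a (Neg b) C x T = place3 a b C (- x) T"
| "place2 a Zer C x T = T"

fun place :: "signed \<Rightarrow> signed \<Rightarrow> signed \<Rightarrow> int \<Rightarrow> table \<Rightarrow> table" where
  "place (Pos a) B C x T = place2 a B C x T"
| "place (Neg a) B C x T = place2 a B C (- x) T"
| "place Zer B C x T = T"

fun single :: "bool \<Rightarrow> nat \<Rightarrow> nat \<Rightarrow> nat \<Rightarrow> nat \<Rightarrow> int \<Rightarrow> table \<Rightarrow> table" where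
  "single s k a b c x T =
     place (Pos (a + k)) (Pos b) (Pos c) x (place (down s a k) (Pos b) (Pos c) x
    (place (Pos a) (Pos (b + k)) (Pos c) x (place (Pos a) (down s b k) (Pos c) x
    (place (Pos a) (Pos b) (Pos (c + k)) x (place (Pos a) (Pos b) (down s c k) x T)))))"

text \<open>The twelve roots \<plusminus>e_i \<plusminus> e_j: one index stays fixed and the other
  two move, with suffix 1 for up and 2 for down.\<close>

fun double :: "signed \<Rightarrow> signed \<Rightarrow> signed \<Rightarrow> signed \<Rightarrow> signed \<Rightarrow> signed \<Rightarrow>
    signed \<Rightarrow> signed \<Rightarrow> signed \<Rightarrow> int \<Rightarrow> table \<Rightarrow> table" where
  "double a a1 a2 b b1 b2 c c1 c2 x T =
     place a b1 c1 x (place a b1 c2 x (place a b2 c1 x (place a b2 c2 x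
    (place a1 b c1 x (place a1 b c2 x (place a2 b c1 x (place a2 b c2 x
    (place a1 b1 c x (place a1 b2 c x (place a2 b1 c x (place a2 b2 c x T)))))))))))"

text \<open>The roots along the axes are \<plusminus>e_i for \<open>SO(7)\<close> and \<plusminus>2
  e_i for \<open>Sp(3)\<close>.\<close>

fun stretch :: "bool \<Rightarrow> nat \<Rightarrow> nat" where
  "stretch False j = j"
| "stretch True j = j + j"

fun shifts :: "bool \<Rightarrow> nat \<Rightarrow> int \<Rightarrow> nat \<Rightarrow> nat \<Rightarrow> nat \<Rightarrow> table \<Rightarrow> table" where
  "shifts s j x a b c T = single s (stretch s j) a b c x
     (double (Pos a) (Pos (a + j)) (down s a j) (Pos b) (Pos (b + j)) (down s b j)
       (Pos c) (Pos (c + j)) (down s c j) x T)"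

fun act0 :: "bool \<Rightarrow> bool \<Rightarrow> nat \<Rightarrow> int \<Rightarrow> nat \<Rightarrow> nat \<Rightarrow> nat \<Rightarrow> table \<Rightarrow> table" where
  "act0 True s j x a b c T = T"
| "act0 False s j x a b c T = shifts s j x a b c T"

fun act1 :: "bool \<Rightarrow> nat \<Rightarrow> nat \<Rightarrow> nat \<Rightarrow> nat \<Rightarrow> int list \<Rightarrow> table \<Rightarrow> table" where
  "act1 s j c b a [] T = T"
| "act1 s j c b a (x # l) T = act1 s j c b (Suc a) l (act0 (x = 0) s j x a b c T)"

fun act2 :: "bool \<Rightarrow> nat \<Rightarrow> nat \<Rightarrow> nat \<Rightarrow> int list list \<Rightarrow> table \<Rightarrow> table" where
  "act2 s j c b [] T = T"
| "act2 s j c b (l # t) T = act2 s j c (Suc b) t (act1 s j c b (Suc b) l T)"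

fun act3 :: "bool \<Rightarrow> nat \<Rightarrow> nat \<Rightarrow> table \<Rightarrow> table \<Rightarrow> table" where
  "act3 s j c [] T = T"
| "act3 s j c (t # W) T = act3 s j (Suc c) W (act2 s j c (Suc c) t T)"

fun sadd1 :: "int \<Rightarrow> int list \<Rightarrow> int list \<Rightarrow> int list" where
  "sadd1 k [] l' = l'"
| "sadd1 k (x # l) [] = k * x # sadd1 k l []"
| "sadd1 k (x # l) (y # l') = (y + k * x) # sadd1 k l l'"

fun sadd2 :: "int \<Rightarrow> int list list \<Rightarrow> int list list \<Rightarrow> int list list" where
  "sadd2 k [] t' = t'"
| "sadd2 k (l # t) [] = sadd1 k l [] # sadd2 k t []"
| "sadd2 k (l # t) (l' # t') = sadd1 k l l' # sadd2 k t t'"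

fun sadd3 :: "int \<Rightarrow> table \<Rightarrow> table \<Rightarrow> table" where
  "sadd3 k [] T' = T'"
| "sadd3 k (t # T) [] = sadd2 k t [] # sadd3 k T []"
| "sadd3 k (t # T) (t' # T') = sadd2 k t t' # sadd3 k T T'"

text \<open>Picks the positions \<open>i\<close>, \<open>i + (j + 1)\<close>,
  \<open>i + 2 (j + 1)\<close> and so on. In a history starting with \<open>P_(m-1)\<close>,
  \<open>every j j\<close> therefore yields \<open>P_(m-(j+1))\<close>, \<open>P_(m-2(j+1))\<close>
  and so on.\<close>

fun every :: "nat \<Rightarrow> nat \<Rightarrow> 'a list \<Rightarrow> 'a list" where
  "every j i [] = []"
| "every j 0 (T # Ts) = T # every j j Ts"
| "every j (Suc i) (T # Ts) = every j i Ts"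

fun comb :: "int list \<Rightarrow> table list \<Rightarrow> table" where
  "comb [] Ts = []"
| "comb (k # ks) [] = []"
| "comb (k # ks) (T # Ts) = sadd3 k T (comb ks Ts)"

fun apply_chi :: "bool \<Rightarrow> nat \<Rightarrow> table \<Rightarrow> table \<Rightarrow> table" where
  "apply_chi s j W T = sadd3 3 W (act3 s j 0 W T)"

text \<open>The right-hand side of the recursion for \<open>m P_m\<close>, with \<open>ks\<close>
  the list of the \<open>d f_d\<close>. The sum over \<open>d\<close> is formed first, so that the
  costly multiplication by \<open>\<chi>(z^j)\<close> is done once for each
  \<open>j\<close>.\<close>

fun newton_sum :: "bool \<Rightarrow> int list \<Rightarrow> nat \<Rightarrow> table list \<Rightarrow> table" where
  "newton_sum s ks 0 Ts = []"
| "newton_sum s ks (Suc j) Ts = apply_chi s (Suc j) (comb ks (every j j Ts)) (newton_sum s ks j Ts)"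

text \<open>The recursion gives \<open>m P_m\<close>. Tables stay integral by integer division,
  whose exactness is checked entry by entry and recorded in the flag.\<close>

fun push :: "int \<Rightarrow> bool \<Rightarrow> table \<Rightarrow> table list \<Rightarrow> bool \<times> table list" where
  "push m ok T Ts = (ok \<and> list_all (list_all (list_all (\<lambda>x. m * (x div m) = x))) T,
     map (map (map (\<lambda>x. x div m))) T # Ts)"

fun run :: "bool \<Rightarrow> int list \<Rightarrow> nat \<Rightarrow> nat \<Rightarrow> bool \<times> table list \<Rightarrow> bool \<times> table list" where
  "run s ks 0 m B = B"
| "run s ks (Suc n) m (ok, Ts) =
     run s ks n (Suc m) (push (int (Suc m)) ok (newton_sum s ks (Suc m) Ts) Ts)"

text \<open>The entry for the weights 2, 1, 0, that is, the coefficient of the alternant of \<rho>;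
  a missing entry counts as 0.\<close>

fun head3 :: "table \<Rightarrow> int" where
  "head3 (((x # l) # t) # T) = x"
| "head3 _ = 0"

fun out :: "bool \<times> table list \<Rightarrow> bool \<times> int list" where
 "out (ok, Ts) = (ok, map head3 Ts)"

text \<open>
  The flag \<open>s\<close> is \<^const>\<open>False\<close> for \<open>SO(7)\<close> and \<^const>\<open>True\<close> for \<open>Sp(3)\<close>.  The index \<open>k\<close> stands for the
  exponent \<open>k + 1 / 2\<close> or \<open>k + 1\<close>, respectively, so that \<open>\<rho>\<close> has the indices 2, 1, 0 in both cases.  For
  \<open>SO(7)\<close> all exponents are raised by \<open>1 / 2\<close> to make them integral, which is harmless as it multiplies
  alternants by a factor of modulus 1.
\<close>

definition skew :: "bool \<Rightarrow> int \<Rightarrow> complex \<Rightarrow> complex" where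
  "skew s k x = x powi (k + 1) - x powi (- (k + of_bool s))"

definition det3 :: "(complex \<Rightarrow> complex) \<Rightarrow> (complex \<Rightarrow> complex) \<Rightarrow> (complex \<Rightarrow> complex) \<Rightarrow>
    complex \<Rightarrow> complex \<Rightarrow> complex \<Rightarrow> complex" where
  "det3 f g h x y w = f x * g y * h w - f x * h y * g w - g x * f y * h w
     + g x * h y * f w + h x * f y * g w - h x * g y * f w"

definition alternant :: "bool \<Rightarrow> nat \<Rightarrow> nat \<Rightarrow> nat \<Rightarrow> complex \<Rightarrow> complex \<Rightarrow> complex \<Rightarrow> complex" where
  "alternant s a b c = det3 (skew s (int a)) (skew s (int b)) (skew s (int c))"

definition pow_sum :: "nat \<Rightarrow> complex \<Rightarrow> complex" where
  "pow_sum n x = x ^ n + 1 / x ^ n"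

text \<open>The adjoint character at the \<open>n\<close>-th powers: 3 for the rank, each product of
  two power sums for four roots \<plusminus>e_i \<plusminus> e_j, and the last three terms for the
  roots along the axes.\<close>

definition adj_char :: "bool \<Rightarrow> nat \<Rightarrow> complex \<Rightarrow> complex \<Rightarrow> complex \<Rightarrow> complex" where
  "adj_char s n x y w = 3
     + (pow_sum n x * pow_sum n y + pow_sum n x * pow_sum n w + pow_sum n y * pow_sum n w)
     + (pow_sum (stretch s n) x + pow_sum (stretch s n) y + pow_sum (stretch s n) w)"

text \<open>The values \<open>V\<close> are left arbitrary because tables are evaluated both at
  alternants and at the torus averages of alternants.\<close>

fun ev1 :: "(nat \<Rightarrow> nat \<Rightarrow> nat \<Rightarrow> complex) \<Rightarrow> nat \<Rightarrow> nat \<Rightarrow> nat \<Rightarrow> int list \<Rightarrow> complex" where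
  "ev1 V c b a [] = 0"
| "ev1 V c b a (x # l) = of_int x * V a b c + ev1 V c b (Suc a) l"

fun ev2 :: "(nat \<Rightarrow> nat \<Rightarrow> nat \<Rightarrow> complex) \<Rightarrow> nat \<Rightarrow> nat \<Rightarrow> int list list \<Rightarrow> complex" where
  "ev2 V c b [] = 0"
| "ev2 V c b (l # t) = ev1 V c b (Suc b) l + ev2 V c (Suc b) t"

fun ev3 :: "(nat \<Rightarrow> nat \<Rightarrow> nat \<Rightarrow> complex) \<Rightarrow> nat \<Rightarrow> table \<Rightarrow> complex" where
  "ev3 V c [] = 0"
| "ev3 V c (t # T) = ev2 V c (Suc c) t + ev3 V (Suc c) T"

section \<open>Correctness of the table operations\<close>

lemma ev1_put1: "ev1 V c b a (put1 r x l) = ev1 V c b a l + of_int x * V (a + r) b c"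
  by (induction r x l arbitrary: a rule: put1.induct) (simp_all add: algebra_simps)

lemma ev2_put2: "ev2 V c b (put2 q r x t) = ev2 V c b t + of_int x * V (b + q + 1 + r) (b + q) c"
  by (induction q r x t arbitrary: b rule: put2.induct) (simp_all add: ev1_put1 algebra_simps)

lemma ev3_put3:
  "ev3 V c (put3 p q r x T) = ev3 V c T + of_int x * V (c + p + q + r + 2) (c + p + q + 1) (c + p)"
  by (induction p q r x T arbitrary: c rule: put3.induct) (simp_all add: ev2_put2 algebra_simps)

lemma ev1_sadd1: "ev1 V c b a (sadd1 k l l') = ev1 V c b a l' + of_int k * ev1 V c b a l"
  by (induction k l l' arbitrary: a rule: sadd1.induct) (simp_all add: algebra_simps)

lemma ev2_sadd2: "ev2 V c b (sadd2 k t t') = ev2 V c b t' + of_int k * ev2 V c b t"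
  by (induction k t t' arbitrary: b rule: sadd2.induct) (simp_all add: ev1_sadd1 algebra_simps)

lemma ev3_sadd3: "ev3 V c (sadd3 k T T') = ev3 V c T' + of_int k * ev3 V c T"
  by (induction k T T' arbitrary: c rule: sadd3.induct) (simp_all add: ev2_sadd2 algebra_simps)

lemma gap_Gt: "gap a b = Gt r \<Longrightarrow> a = b + 1 + r"
  and gap_Eq: "gap a b = Eq \<Longrightarrow> a = b"
  and gap_Lt: "gap a b = Lt r \<Longrightarrow> b = a + 1 + r"
  by (induction a b rule: gap.induct) auto

fun signed_skew :: "bool \<Rightarrow> signed \<Rightarrow> complex \<Rightarrow> complex" where
  "signed_skew s (Pos a) x = skew s (int a) x"
| "signed_skew s (Neg a) x = - skew s (int a) x"
| "signed_skew s Zer x = 0"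

text \<open>Once the index has dropped below 0, \<open>reflect\<close> applies the oddness of
  \<open>skew\<close> about its centre of symmetry.\<close>

lemma signed_skew_down: "signed_skew s (down s a j) x = skew s (int a - int j) x"
proof (induction s a j rule: down.induct)
  case (3 s j)
  show ?case by (cases "(s, j)" rule: reflect.cases) (auto simp: skew_def algebra_simps)
qed auto

abbreviation alternant_at :: "bool \<Rightarrow> complex \<Rightarrow> complex \<Rightarrow> complex \<Rightarrow> nat \<Rightarrow> nat \<Rightarrow> nat \<Rightarrow> complex" where
  "alternant_at s x y w \<equiv> \<lambda>a b c. alternant s a b c x y w"

lemma alternant_swap:
  "alternant s a b c x y w = - alternant s b a c x y w"
  "alternant s a b c x y w = - alternant s a c b x y w"
  by (simp_all add: alternant_def det3_def)

lemma alternant_eq: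
  "alternant s a a c x y w = 0" "alternant s a c c x y w = 0"
  by (simp_all add: alternant_def det3_def)

lemma ev3_sort3:
  assumes "m = gap r q"
  shows "ev3 (alternant_at s x y w) 0 (sort3 m b q r k T)
    = ev3 (alternant_at s x y w) 0 T + of_int k * alternant s (b + 1 + r) b (b + 1 + q) x y w"
proof (cases m)
  case (Gt r')
  with assms have "r = q + 1 + r'" by (metis gap_Gt)
  with Gt show ?thesis
    by (simp add: ev3_put3 alternant_swap(2)[of s _ b] add_ac)
next
  case Eq
  with assms have "r = q" by (metis gap_Eq)
  with Eq show ?thesis
    by (simp add: alternant_swap(2)[of s _ b] alternant_eq)
next
  case (Lt r')
  with assms have "q = r + 1 + r'" by (metis gap_Lt)
  with Lt show ?thesis
    by (simp add: ev3_put3 alternant_swap(2)[of s _ b] alternant_swap(1)[of s "Suc (b + r)"] add_ac)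
qed

lemma ev3_sort2:
  assumes "m = gap b c"
  shows "ev3 (alternant_at s x y w) 0 (sort2 m r b c k T)
    = ev3 (alternant_at s x y w) 0 T + of_int k * alternant s (b + 1 + r) b c x y w"
proof (cases m)
  case (Gt q)
  with assms have "b = c + 1 + q" by (metis gap_Gt)
  with Gt show ?thesis by (simp add: ev3_put3 add_ac)
next
  case Eq
  with assms have "b = c" by (metis gap_Eq)
  with Eq show ?thesis by (simp add: alternant_eq)
next
  case (Lt q)
  with assms have "c = b + 1 + q" by (metis gap_Lt)
  with Lt show ?thesis by (simp add: ev3_sort3)
qed

lemma ev3_sort1:
  assumes "m = gap a b"
  shows "ev3 (alternant_at s x y w) 0 (sort1 m a b c k T) = ev3 (alternant_at s x y w) 0 T + of_int k * alternant s a b c x y w"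
proof (cases m)
  case (Gt r)
  with assms have "a = b + 1 + r" by (metis gap_Gt)
  with Gt show ?thesis by (simp add: ev3_sort2)
next
  case Eq
  with assms have "a = b" by (metis gap_Eq)
  with Eq show ?thesis by (simp add: alternant_eq)
next
  case (Lt r)
  with assms have "b = a + 1 + r" by (metis gap_Lt)
  with Lt show ?thesis by (simp add: ev3_sort2 alternant_swap(1)[of s a])
qed

lemma ev3_place:
  "ev3 (alternant_at s x y w) 0 (place A B C k T) = ev3 (alternant_at s x y w) 0 T
     + of_int k * det3 (signed_skew s A) (signed_skew s B) (signed_skew s C) x y w"
proof -
  define V where "V = alternant_at s x y w"
  note sort1 = ev3_sort1[OF refl, of s x y w, folded V_def, unfolded alternant_def]
  have 3: "ev3 V 0 (place3 a b C k T)
     = ev3 V 0 T + of_int k * det3 (skew s (int a)) (skew s (int b)) (signed_skew s C) x y w" for a b k T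
    by (cases C) (simp_all add: sort1 det3_def algebra_simps)
  have 2: "ev3 V 0 (place2 a B C k T)
     = ev3 V 0 T + of_int k * det3 (skew s (int a)) (signed_skew s B) (signed_skew s C) x y w" for a k T
    by (cases B) (simp_all add: 3 det3_def algebra_simps)
  show ?thesis
    unfolding V_def[symmetric]
    by (cases A) (simp_all add: 2 det3_def algebra_simps)
qed

text \<open>Multiplication by \<open>x^j + x^(-j)\<close> is symmetric under inversion, so it shifts
  both powers in a skew function, up and down, and preserves their antisymmetry. This is the
  one-variable case of the action of the character on alternants.\<close>

lemma pow_sum_times_skew:
  assumes "x \<noteq> 0"
  shows "skew s (k + int j) x + skew s (k - int j) x = pow_sum j x * skew s k x"
  using assms
  by (simp add: skew_def pow_sum_def power_int_add power_int_diff power_int_minus field_simps)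

lemma ev3_shifts:
  fixes s :: bool and x y w :: complex
  assumes "x \<noteq> 0" "y \<noteq> 0" "w \<noteq> 0"
  defines "V \<equiv> alternant_at s x y w"
  shows "ev3 V 0 (shifts s j k a b c T)
    = ev3 V 0 T + of_int k * (adj_char s j x y w - 3) * V a b c"
proof -
  define f where "f a = skew s (int a)" for a
  define u where "u = pow_sum j"
  define v where "v = pow_sum (stretch s j)"
  define P where "P a = signed_skew s (Pos a)" for a
  define D where "D a i = signed_skew s (down s a i)" for a i
  have P: "P a = f a" for a
    by (auto simp: P_def f_def)
  \<comment> \<open>Eliminating the upward shifts leaves only the downward ones, which cancel; what
    remains is a polynomial identity.\<close>
  have up: "P (a + i) z = pow_sum i z * f a z - D a i z" if "z \<noteq> 0" for a i z
    using pow_sum_times_skew[OF that, of s "int a" i]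
    by (simp add: P_def D_def f_def signed_skew_down algebra_simps)
  have *: "ev3 V 0 (place A B C k T)
     = ev3 V 0 T + of_int k * det3 (signed_skew s A) (signed_skew s B) (signed_skew s C) x y w" for A B C k T
    unfolding V_def by (rule ev3_place)
  have V: "V a b c = det3 (f a) (f b) (f c) x y w"
    by (simp add: V_def alternant_def f_def)
  show ?thesis
    unfolding shifts.simps single.simps double.simps * V adj_char_def
      P_def[symmetric] D_def[symmetric] u_def[symmetric] v_def[symmetric]
      det3_def up[OF assms(1)] up[OF assms(2)] up[OF assms(3)]
    unfolding P by algebra
qed

lemma ev3_act3:
  fixes s :: bool and x y w :: complex
  assumes "x \<noteq> 0" "y \<noteq> 0" "w \<noteq> 0"
  defines "V \<equiv> alternant_at s x y w"
  shows "ev3 V 0 (act3 s j c W T) = ev3 V 0 T + (adj_char s j x y w - 3) * ev3 V c W"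
proof -
  define K where "K = adj_char s j x y w - 3"
  have 0: "ev3 V 0 (act0 (k = 0) s j k a b c T) = ev3 V 0 T + of_int k * K * V a b c" for k a b c T
    using ev3_shifts[OF assms(1-3), of s j k a b c T] by (cases "k = 0") (simp_all add: V_def K_def)
  have 1: "ev3 V 0 (act1 s j c b a l T) = ev3 V 0 T + K * ev1 V c b a l" for c b a l T
    by (induction l arbitrary: a T) (simp_all add: 0 algebra_simps)
  have 2: "ev3 V 0 (act2 s j c b t T) = ev3 V 0 T + K * ev2 V c b t" for c b t T
    by (induction t arbitrary: b T) (simp_all add: 1 algebra_simps)
  have "ev3 V 0 (act3 s j c W T) = ev3 V 0 T + K * ev3 V c W"
    by (induction W arbitrary: c T) (simp_all add: 2 algebra_simps)
  then show ?thesis unfolding K_def .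
qed

text \<open>\<open>comb\<close> stops at the end of the shorter list; the default value 0 beyond the
  history corresponds to coefficients \<open>P\<close> of negative index.\<close>

lemma ev3_comb_every:
  "ev3 V 0 (comb ks (every j i Ts))
     = (\<Sum>d<length ks. of_int (ks ! d) * nth_default 0 (map (ev3 V 0) Ts) (i + d * Suc j))"
proof (induction j i Ts arbitrary: ks rule: every.induct)
  case (1 j i)
  then show ?case by (cases ks) (simp_all add: nth_default_def)
next
  case (2 j T Ts)
  show ?case
  proof (cases ks)
    case (Cons k ks')
    have "ev3 V 0 (comb ks (every j 0 (T # Ts)))
        = of_int k * ev3 V 0 T + ev3 V 0 (comb ks' (every j j Ts))"
      by (simp add: Cons ev3_sadd3 add.commute)
    also have "\<dots> = (\<Sum>d<length ks. of_int (ks ! d)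
        * nth_default 0 (map (ev3 V 0) (T # Ts)) (0 + d * Suc j))"
      unfolding "2.IH" Cons by (simp add: sum.lessThan_Suc_shift add_ac del: sum.lessThan_Suc)
    finally show ?thesis .
  qed simp
next
  case (3 j i T Ts)
  then show ?case by (cases ks) simp_all
qed

lemma ev3_newton_sum:
  fixes s :: bool and x y w :: complex
  assumes "x \<noteq> 0" "y \<noteq> 0" "w \<noteq> 0"
  defines "V \<equiv> alternant_at s x y w"
  shows "ev3 V 0 (newton_sum s ks j Ts) = (\<Sum>i=1..j. adj_char s i x y w
     * (\<Sum>d<length ks. of_int (ks ! d) * nth_default 0 (map (ev3 V 0) Ts) (i * Suc d - 1)))"
  using assms
  by (induction j)
     (simp_all add: ev3_sadd3 ev3_act3 ev3_comb_every algebra_simps)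

lemma ev3_exact_div:
  assumes "list_all (list_all (list_all (\<lambda>x. m * (x div m) = x))) T"
  shows "of_int m * ev3 V c (map (map (map (\<lambda>x. x div m))) T) = ev3 V c T"
proof -
  have "of_int m * of_int (x div m) = (of_int x :: complex)" if "m * (x div m) = x" for x
    by (metis of_int_mult that)
  then have 1: "of_int m * ev1 V c b a (map (\<lambda>x. x div m) l) = ev1 V c b a l"
    if "list_all (\<lambda>x. m * (x div m) = x) l" for c b a l
    using that by (induction l arbitrary: a) (auto simp: algebra_simps)
  have 2: "of_int m * ev2 V c b (map (map (\<lambda>x. x div m)) t) = ev2 V c b t"
    if "list_all (list_all (\<lambda>x. m * (x div m) = x)) t" for c b t
    using that 1 by (induction t arbitrary: b) (auto simp: algebra_simps)
  show ?thesis
    using assms 2 by (induction T arbitrary: c) (auto simp: algebra_simps)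
qed

text \<open>The history \<open>Ts\<close> lists the tables with the most recent one first.\<close>

lemma ev3_run:
  fixes s :: bool and x y w :: complex
  assumes nz: "x \<noteq> 0" "y \<noteq> 0" "w \<noteq> 0"
  defines "V \<equiv> alternant_at s x y w"
  assumes rec: "\<And>m. m \<le> M \<Longrightarrow> of_nat m * p m = (\<Sum>j=1..m. adj_char s j x y w
     * (\<Sum>d<length ks. of_int (ks ! d) * (if j * Suc d \<le> m then p (m - j * Suc d) else 0)))"
  assumes run: "run s ks n m (ok, Ts) = (True, Ts')"
    and hist: "map (ev3 V 0) Ts = map (\<lambda>i. p (m - i) * r) [0..<Suc m]"
    and le: "m + n \<le> M"
  shows "map (ev3 V 0) Ts' = map (\<lambda>i. p (m + n - i) * r) [0..<Suc (m + n)]"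
  using run hist le
proof (induction n arbitrary: m ok Ts)
  case (Suc n)
  define R where "R = newton_sum s ks (Suc m) Ts"
  define Q where "Q = map (map (map (\<lambda>x. x div int (Suc m)))) R"
  define ok' where "ok' = list_all (list_all (list_all (\<lambda>x. int (Suc m) * (x div int (Suc m)) = x))) R"
  have run': "run s ks n (Suc m) (ok \<and> ok', Q # Ts) = (True, Ts')"
    using Suc.prems(1) by (simp add: R_def Q_def ok'_def)
  \<comment> \<open>The flag never returns to true, so a true flag at the end certifies every
    division on the way.\<close>
  have flag: "b" if "run s ks n m (b, Ts) = (True, Ts')" for n m b Ts
    using that by (induction n arbitrary: m b Ts) auto
  have ok': "ok'" using flag[OF run'] by simp
  have len: "length Ts = Suc m"
    using arg_cong[OF Suc.prems(2), of length] by simp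
  \<comment> \<open>The history starts with \<open>p m\<close>, so \<open>p (Suc m - k)\<close>
    stands at position \<open>k - 1\<close>.\<close>
  have nth: "nth_default 0 (map (ev3 V 0) Ts) (j * Suc d - 1)
      = (if j * Suc d \<le> Suc m then p (Suc m - j * Suc d) else 0) * r" if "1 \<le> j" for j d
  proof -
    have "1 \<le> j * Suc d" using that by simp
    then show ?thesis
      unfolding Suc.prems(2) nth_default_def by (auto simp del: upt_Suc mult_Suc_right)
  qed
  have newton_sum: "ev3 V 0 R = (\<Sum>j=1..Suc m. adj_char s j x y w
      * (\<Sum>d<length ks. of_int (ks ! d) * nth_default 0 (map (ev3 V 0) Ts) (j * Suc d - 1)))"
    unfolding R_def V_def by (rule ev3_newton_sum[OF nz])
  have "of_nat (Suc m) * ev3 V 0 Q = ev3 V 0 R"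
    using ev3_exact_div[OF ok'[unfolded ok'_def], of V 0] by (simp add: Q_def)
  also have "\<dots> = (\<Sum>j=1..Suc m. adj_char s j x y w
      * (\<Sum>d<length ks. of_int (ks ! d)
        * ((if j * Suc d \<le> Suc m then p (Suc m - j * Suc d) else 0) * r)))"
    unfolding newton_sum by (intro sum.cong refl arg_cong2[where f = "(*)"] nth) simp
  also have "\<dots> = (\<Sum>j=1..Suc m. adj_char s j x y w
     * (\<Sum>d<length ks. of_int (ks ! d) * (if j * Suc d \<le> Suc m then p (Suc m - j * Suc d) else 0))) * r"
    by (simp only: sum_distrib_left sum_distrib_right mult.assoc)
  also have "\<dots> = of_nat (Suc m) * (p (Suc m) * r)"
    using rec[of "Suc m"] Suc.prems(3) by simp
  finally have "ev3 V 0 Q = p (Suc m) * r"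
    by (simp del: of_nat_Suc)
  moreover have "map (\<lambda>i. p (Suc m - i) * r) [0..<Suc (Suc m)]
      = p (Suc m) * r # map (\<lambda>i. p (m - i) * r) [0..<Suc m]"
    by (subst upt_conv_Cons) (simp_all add: map_Suc_upt[symmetric] del: upt_Suc)
  ultimately have "map (ev3 V 0) (Q # Ts) = map (\<lambda>i. p (Suc m - i) * r) [0..<Suc (Suc m)]"
    using Suc.prems(2) by simp
  from Suc.IH[OF run' this] Suc.prems(3) show ?case by simp
qed simp

section \<open>Averages over the torus\<close>

definition avg :: "(complex \<Rightarrow> complex) \<Rightarrow> complex" where
  "avg F = contour_integral (circlepath 0 1) (\<lambda>w. F w / (2 * of_real pi * \<i> * w))"

definition avg3 :: "(complex \<Rightarrow> complex \<Rightarrow> complex \<Rightarrow> complex) \<Rightarrow> complex" where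
  "avg3 G = avg (\<lambda>w. avg (\<lambda>y. avg (\<lambda>x. G x y w)))"

abbreviation circ :: "complex set" where
  "circ \<equiv> sphere 0 1"

definition cont3 :: "(complex \<Rightarrow> complex \<Rightarrow> complex \<Rightarrow> complex) \<Rightarrow> bool" where
  "cont3 G \<longleftrightarrow> continuous_on (circ \<times> circ \<times> circ) (\<lambda>(x, y, w). G x y w)"

lemma torus_integral_3:
  "torus_integral 3 f = avg3 (\<lambda>x y w. f ((\<lambda>_. 1)(0 := x, 1 := y, 2 := w)))"
  by (simp add: avg3_def avg_def numeral_3_eq_3 numeral_2_eq_2)

lemma avg_eq_integral: "avg F = integral {0..1} (\<lambda>x. F (exp (2 * of_real pi * \<i> * of_real x)))"
  unfolding avg_def contour_integral_integral vector_derivative_circlepath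
  by (simp add: circlepath algebra_simps)

lemma exp_circ: "exp (2 * of_real pi * \<i> * of_real x) \<in> circ"
  by (simp add: norm_exp_eq_Re)

lemma continuous_circ_param:
  assumes "continuous_on circ F"
  shows "continuous_on A (\<lambda>x::real. F (exp (2 * of_real pi * \<i> * of_real x)))"
  by (rule continuous_on_compose2[OF assms]) (use exp_circ in \<open>auto intro!: continuous_intros\<close>)

lemma integrable_circ_param:
  fixes F :: "complex \<Rightarrow> complex"
  assumes "continuous_on circ F"
  shows "(\<lambda>x::real. F (exp (2 * of_real pi * \<i> * of_real x))) integrable_on {0..1}"
  by (intro integrable_continuous_real continuous_circ_param assms)

lemma avg_add:
  assumes "continuous_on circ F" "continuous_on circ G"
  shows "avg (\<lambda>x. F x + G x) = avg F + avg G"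
  unfolding avg_eq_integral using assms by (intro integral_add integrable_circ_param)

lemma avg_cmult: "avg (\<lambda>x. c * F x) = c * avg F"
  unfolding avg_eq_integral by simp

lemma avg_mult_right: "avg (\<lambda>x. F x * c) = avg F * c"
  unfolding avg_eq_integral by simp

lemma avg_const: "avg (\<lambda>x. c) = c"
  unfolding avg_eq_integral by simp

lemma avg_norm_le:
  assumes "continuous_on circ F" "\<And>x. x \<in> circ \<Longrightarrow> norm (F x) \<le> B"
  shows "norm (avg F) \<le> B"
proof -
  have "norm (integral {0..1} (\<lambda>x::real. F (exp (2 * of_real pi * \<i> * of_real x)))) \<le> B * (1 - 0)"
    by (rule integral_bound) (use assms exp_circ continuous_circ_param in auto)
  then show ?thesis by (simp add: avg_eq_integral)
qed

text \<open>The parametrisation of the circle is injective on \<open>[0, 1)\<close>, so a finite set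
  of points has a finite, hence negligible, preimage.\<close>

lemma avg_cong_finite:
  assumes "finite A" "\<And>x. x \<in> circ - A \<Longrightarrow> F x = G x"
  shows "avg F = avg G"
proof -
  let ?e = "\<lambda>x::real. exp (2 * of_real pi * \<i> * of_real x)"
  have "inj_on ?e {0..<1}"
  proof (rule inj_onI)
    fix u v :: real assume *: "u \<in> {0..<1}" "v \<in> {0..<1}" "?e u = ?e v"
    then obtain n :: int where "2 * of_real pi * \<i> * of_real u
        = 2 * of_real pi * \<i> * of_real v + (of_int (2 * n) * pi) * \<i>"
      using exp_eq by blast
    then have "2 * pi * u = 2 * pi * v + of_int (2 * n) * pi"
      by (auto simp: complex_eq_iff)
    then have "2 * pi * (u - v - of_int n) = 0" by (simp add: algebra_simps)
    then have "u = v + of_int n" by auto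
    moreover have "n = 0" using * calculation by auto
    ultimately show "u = v" by simp
  qed
  then have "finite (?e -` A \<inter> {0..<1})"
    by (intro finite_vimage_IntI assms(1))
  \<comment> \<open>The endpoint 1 lies outside the half-open interval of injectivity and is added
    separately.\<close>
  then have "finite (insert 1 (?e -` A \<inter> {0..<1}))" by simp
  then have "negligible (insert 1 (?e -` A \<inter> {0..<1}))" by (rule negligible_finite)
  then show ?thesis
    unfolding avg_eq_integral
    by (rule integral_spike) (use assms(2) exp_circ in force)
qed

lemma avg_cong: "(\<And>x. x \<in> circ \<Longrightarrow> F x = G x) \<Longrightarrow> avg F = avg G"
  by (rule avg_cong_finite[of "{}"]) auto

lemma continuous_avg:
  fixes U :: "'a::t2_space set"
  assumes "continuous_on (U \<times> circ) (\<lambda>(u, x). g u x)"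
  shows "continuous_on U (\<lambda>u. avg (g u))"
  unfolding avg_eq_integral cbox_interval[symmetric]
proof (rule integral_continuous_on_param)
  show "continuous_on (U \<times> cbox 0 1)
     (\<lambda>(u, x::real). g u (exp (2 * of_real pi * \<i> * of_real x)))"
    unfolding case_prod_beta
    by (rule continuous_on_compose2[OF assms[unfolded case_prod_beta],
          where f = "\<lambda>p. (fst p, exp (2 * of_real pi * \<i> * of_real (snd p)))", simplified])
       (use exp_circ in \<open>auto intro!: continuous_intros\<close>)
qed

lemma cont3_slice1:
  assumes "cont3 G" "y \<in> circ" "w \<in> circ"
  shows "continuous_on circ (\<lambda>x. G x y w)"
  by (rule continuous_on_compose2[OF assms(1)[unfolded cont3_def case_prod_beta],
        where f = "\<lambda>x. (x, y, w)", simplified])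
     (use assms in \<open>auto intro!: continuous_intros\<close>)

lemma cont3_slice2:
  assumes "cont3 G" "w \<in> circ"
  shows "continuous_on circ (\<lambda>y. avg (\<lambda>x. G x y w))"
proof (rule continuous_avg)
  show "continuous_on (circ \<times> circ) (\<lambda>(y, x). G x y w)"
    unfolding case_prod_beta
    by (rule continuous_on_compose2[OF assms(1)[unfolded cont3_def case_prod_beta],
        where f = "\<lambda>p. (snd p, fst p, w)", simplified])
     (use assms in \<open>auto intro!: continuous_intros\<close>)
qed

lemma cont3_slice3:
  assumes "cont3 G"
  shows "continuous_on circ (\<lambda>w. avg (\<lambda>y. avg (\<lambda>x. G x y w)))"
proof (rule continuous_avg)
  have "continuous_on (circ \<times> circ) (\<lambda>p. avg (\<lambda>x. G x (snd p) (fst p)))"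
  proof (rule continuous_avg)
    show "continuous_on ((circ \<times> circ) \<times> circ) (\<lambda>(p, x). G x (snd p) (fst p))"
      unfolding case_prod_beta
      by (rule continuous_on_compose2[OF assms(1)[unfolded cont3_def case_prod_beta],
          where f = "\<lambda>p. (snd p, snd (fst p), fst (fst p))", simplified])
       (use assms in \<open>auto intro!: continuous_intros\<close>)
  qed
  then show "continuous_on (circ \<times> circ) (\<lambda>(w, y). avg (\<lambda>x. G x y w))"
    by (simp add: case_prod_beta)
qed

lemma avg3_add:
  assumes "cont3 F" "cont3 G"
  shows "avg3 (\<lambda>x y w. F x y w + G x y w) = avg3 F + avg3 G"
proof -
  have "avg3 (\<lambda>x y w. F x y w + G x y w)
    = avg (\<lambda>w. avg (\<lambda>y. avg (\<lambda>x. F x y w) + avg (\<lambda>x. G x y w)))"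
    unfolding avg3_def using assms by (intro avg_cong avg_add cont3_slice1) auto
  also have "\<dots> = avg (\<lambda>w. avg (\<lambda>y. avg (\<lambda>x. F x y w)) + avg (\<lambda>y. avg (\<lambda>x. G x y w)))"
    using assms by (intro avg_cong avg_add cont3_slice2) auto
  also have "\<dots> = avg3 F + avg3 G"
    unfolding avg3_def using assms by (intro avg_add cont3_slice3) auto
  finally show ?thesis .
qed

lemma avg3_cmult: "avg3 (\<lambda>x y w. c * F x y w) = c * avg3 F"
  by (simp add: avg3_def avg_cmult)

lemma avg3_prod: "avg3 (\<lambda>x y w. f x * g y * h w) = avg f * avg g * avg h"
  by (simp add: avg3_def avg_cmult avg_mult_right)

lemma avg3_norm_le:
  assumes "cont3 F" "\<And>x y w. x \<in> circ \<Longrightarrow> y \<in> circ \<Longrightarrow> w \<in> circ \<Longrightarrow> norm (F x y w) \<le> B"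
  shows "norm (avg3 F) \<le> B"
  unfolding avg3_def using assms
  by (intro avg_norm_le cont3_slice1 cont3_slice2 cont3_slice3) auto

lemma avg3_cong:
  assumes "\<And>x y w. x \<in> circ \<Longrightarrow> y \<in> circ \<Longrightarrow> w \<in> circ \<Longrightarrow> F x y w = G x y w"
  shows "avg3 F = avg3 G"
  unfolding avg3_def using assms by (intro avg_cong) auto

text \<open>The excluded points contain all those where some root equals 1. With the outer variables
  fixed, each circle loses only finitely many points, so the exceptions are removed one variable at
  a time.\<close>

lemma avg3_cong_generic:
  assumes "\<And>x y w. \<lbrakk>x \<in> circ; y \<in> circ; w \<in> circ; w \<notin> {1, -1}; y \<notin> {1, -1, w, 1 / w};
      x \<notin> {1, -1, y, 1 / y, w, 1 / w}\<rbrakk> \<Longrightarrow> F x y w = G x y w"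
  shows "avg3 F = avg3 G"
  unfolding avg3_def
  by (rule avg_cong_finite[of "{1, -1}"], simp,
      rule avg_cong_finite[of "{1, -1, _, 1 / _}"], simp,
      rule avg_cong_finite[of "{1, -1, _, 1 / _, _, 1 / _}"], simp, rule assms) auto

text \<open>For nonzero \<open>k\<close> the integrand has the primitive
  \<open>z^k / (2 \<pi> i k)\<close> on the punctured plane.\<close>

lemma avg_power_int: "avg (\<lambda>x. x powi k) = of_bool (k = 0)"
proof (cases "k = 0")
  case False
  have "((\<lambda>z. z powi k / (of_int k * (2 * of_real pi * \<i>))) has_field_derivative
      z powi k / (2 * of_real pi * \<i> * z)) (at z within - {0})" if "z \<in> - {0}" for z
    using that False
    by (auto intro!: derivative_eq_intros simp: power_int_diff field_simps)
  then have "((\<lambda>z. z powi k / (2 * of_real pi * \<i> * z)) has_contour_integral 0) (circlepath 0 1)"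
    by (rule Cauchy_theorem_primitive[where S = "- {0}"]) (auto simp: path_image_circlepath)
  then show ?thesis
    unfolding avg_def using False by (simp add: contour_integral_unique)
qed (simp add: avg_const)

lemma cont3_const [intro]: "cont3 (\<lambda>x y w. c)"
  by (simp add: cont3_def case_prod_beta)

lemma cont3_coord [intro]:
  assumes "continuous_on circ f"
  shows "cont3 (\<lambda>x y w. f x)" "cont3 (\<lambda>x y w. f y)" "cont3 (\<lambda>x y w. f w)"
  unfolding cont3_def case_prod_beta
  by (rule continuous_on_compose2[OF assms]; auto intro!: continuous_intros)+

lemma cont3_add [intro]: "cont3 F \<Longrightarrow> cont3 G \<Longrightarrow> cont3 (\<lambda>x y w. F x y w + G x y w)"
  and cont3_diff [intro]: "cont3 F \<Longrightarrow> cont3 G \<Longrightarrow> cont3 (\<lambda>x y w. F x y w - G x y w)"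
  and cont3_mult [intro]: "cont3 F \<Longrightarrow> cont3 G \<Longrightarrow> cont3 (\<lambda>x y w. F x y w * G x y w)"
  by (simp_all add: cont3_def case_prod_beta continuous_intros)

lemma cont3_sum [intro]: "(\<And>i. i \<in> I \<Longrightarrow> cont3 (F i)) \<Longrightarrow> cont3 (\<lambda>x y w. \<Sum>i\<in>I. F i x y w)"
  by (simp add: cont3_def case_prod_beta continuous_intros)

lemma avg3_diff:
  assumes "cont3 F" "cont3 G"
  shows "avg3 (\<lambda>x y w. F x y w - G x y w) = avg3 F - avg3 G"
  using avg3_add[OF assms(1) cont3_mult[OF cont3_const assms(2)], of "-1"]
    avg3_cmult[of "-1" G] by simp

lemma avg3_const: "avg3 (\<lambda>x y w. c) = c"
  by (simp add: avg3_def avg_const)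

lemma avg3_sum:
  assumes "finite I" "\<And>i. i \<in> I \<Longrightarrow> cont3 (F i)"
  shows "avg3 (\<lambda>x y w. \<Sum>i\<in>I. F i x y w) = (\<Sum>i\<in>I. avg3 (F i))"
  using assms by (induction I) (auto simp: avg3_add cont3_sum avg3_const)

section \<open>Orthogonality of the alternants\<close>

definition pairing :: "(complex \<Rightarrow> complex) \<Rightarrow> (complex \<Rightarrow> complex) \<Rightarrow> complex" where
  "pairing f g = avg (\<lambda>x. f x * g (1 / x))"

lemma cont3_prod:
  assumes "continuous_on circ f" "continuous_on circ g" "continuous_on circ h"
  shows "cont3 (\<lambda>x y w. f x * g y * h w)"
  using assms by (intro cont3_mult cont3_coord)

lemma continuous_on_circ_inverse:
  assumes "continuous_on circ g"
  shows "continuous_on circ (\<lambda>x. g (1 / x))"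
  by (rule continuous_on_compose2[OF assms]) (auto intro!: continuous_intros simp: norm_divide)

text \<open>Andreief's identity: the average is 3! times the determinant of the pairings. Expanding
  the first determinant gives six terms, and each of them averages to that same determinant once its
  permutation sign is absorbed.\<close>

lemma avg3_det3:
  assumes "continuous_on circ f" "continuous_on circ g" "continuous_on circ h"
    and "continuous_on circ f'" "continuous_on circ g'" "continuous_on circ h'"
  shows "avg3 (\<lambda>x y w. det3 f g h x y w * det3 f' g' h' (1 / x) (1 / y) (1 / w)) =
    6 * (pairing f f' * pairing g g' * pairing h h' - pairing f f' * pairing g h' * pairing h g'
       - pairing f g' * pairing g f' * pairing h h' + pairing f g' * pairing g h' * pairing h f'
       + pairing f h' * pairing g f' * pairing h g' - pairing f h' * pairing g g' * pairing h f')"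
proof -
  let ?T = "\<lambda>f g h x y w. f x * g y * h w * det3 f' g' h' (1 / x) (1 / y) (1 / w)"
  have cont: "continuous_on circ (\<lambda>x. u x * v (1 / x))"
    if "continuous_on circ u" "continuous_on circ v" for u v :: "complex \<Rightarrow> complex"
    using that by (intro continuous_intros continuous_on_circ_inverse)
  \<comment> \<open>Stated for arbitrary \<open>f\<close>, \<open>g\<close>, \<open>h\<close>, so
    that it serves all six permutations of the rows.\<close>
  have row: "avg3 (?T f g h)
      = pairing f f' * pairing g g' * pairing h h' - pairing f f' * pairing g h' * pairing h g'
       - pairing f g' * pairing g f' * pairing h h' + pairing f g' * pairing g h' * pairing h f'
       + pairing f h' * pairing g f' * pairing h g' - pairing f h' * pairing g g' * pairing h f'"
    and cont_row: "cont3 (?T f g h)"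
    if c: "continuous_on circ f" "continuous_on circ g" "continuous_on circ h" for f g h
  proof -
    define P where "P u v t = (\<lambda>x y w. (f x * u (1 / x)) * (g y * v (1 / y)) * (h w * t (1 / w)))"
      for u v t
    have P: "avg3 (P u v t) = pairing f u * pairing g v * pairing h t" for u v t
      unfolding P_def pairing_def by (rule avg3_prod)
    have cP: "cont3 (P u v t)"
      if "continuous_on circ u" "continuous_on circ v" "continuous_on circ t" for u v t
      unfolding P_def using that c by (intro cont3_prod cont)
    have T: "?T f g h = (\<lambda>x y w. P f' g' h' x y w - P f' h' g' x y w - P g' f' h' x y w
        + P g' h' f' x y w + P h' f' g' x y w - P h' g' f' x y w)"
      by (simp add: P_def det3_def fun_eq_iff algebra_simps)
    show "cont3 (?T f g h)"
      unfolding T using assms by (intro cont3_add cont3_diff cP)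
    show "avg3 (?T f g h)
      = pairing f f' * pairing g g' * pairing h h' - pairing f f' * pairing g h' * pairing h g'
       - pairing f g' * pairing g f' * pairing h h' + pairing f g' * pairing g h' * pairing h f'
       + pairing f h' * pairing g f' * pairing h g' - pairing f h' * pairing g g' * pairing h f'"
      unfolding T using assms
      by (simp add: avg3_add avg3_diff cont3_add cont3_diff cP P)
  qed
  have "(\<lambda>x y w. det3 f g h x y w * det3 f' g' h' (1 / x) (1 / y) (1 / w)) = (\<lambda>x y w.
      ?T f g h x y w - ?T f h g x y w - ?T g f h x y w
      + ?T g h f x y w + ?T h f g x y w - ?T h g f x y w)"
    by (simp add: det3_def[of f g h] fun_eq_iff algebra_simps)
  then have "avg3 (\<lambda>x y w. det3 f g h x y w * det3 f' g' h' (1 / x) (1 / y) (1 / w)) =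
      avg3 (?T f g h) - avg3 (?T f h g) - avg3 (?T g f h)
      + avg3 (?T g h f) + avg3 (?T h f g) - avg3 (?T h g f)"
    using assms by (simp add: avg3_add avg3_diff cont3_add cont3_diff cont_row)
  then show ?thesis
    using assms by (simp add: row)
qed

lemma continuous_on_skew: "continuous_on circ (skew s k)"
  unfolding skew_def by (auto intro!: continuous_intros)

text \<open>Of the four products of powers, two have exponent \<open>k - l\<close> up to sign and
  average to 1 exactly if \<open>k = l\<close>. The other two have exponent
  \<open>k + l + 1 + e\<close> up to sign, which is nonzero for natural \<open>k\<close> and
  \<open>l\<close>.\<close>

lemma pairing_skew: "pairing (skew s (int k)) (skew s (int l)) = 2 * of_bool (k = l)"
proof -
  define e :: int where "e = of_bool s"
  have e: "e \<ge> 0" by (simp add: e_def)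
  have c: "continuous_on circ (\<lambda>x. x powi n)" for n
    by (auto intro!: continuous_intros)
  have "skew s (int k) x * skew s (int l) (1 / x) =
      (x powi (int k - int l) + x powi (int l - int k))
      + (-1 * x powi (int k + int l + 1 + e) + -1 * x powi (- (int k + int l + 1 + e)))"
    if "x \<in> circ" for x
    using that
    by (auto simp: skew_def e_def power_int_add power_int_diff power_int_minus power_int_divide_distrib
        field_simps)
  then have "pairing (skew s (int k)) (skew s (int l)) = avg (\<lambda>x.
      (x powi (int k - int l) + x powi (int l - int k))
      + (-1 * x powi (int k + int l + 1 + e) + -1 * x powi (- (int k + int l + 1 + e))))"
    unfolding pairing_def by (rule avg_cong)
  also have "\<dots> = of_bool (int k - int l = 0) + of_bool (int l - int k = 0)
      - of_bool (int k + int l + 1 + e = 0) - of_bool (- (int k + int l + 1 + e) = 0)"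
    by (subst avg_add avg_cmult avg_power_int; (intro continuous_intros c)?)+ simp
  also have "\<dots> = 2 * of_bool (k = l)"
    using e by auto
  finally show ?thesis .
qed

text \<open>Two strictly decreasing triples can match only under the identity permutation. The value
  48 is the order of the Weyl group, 3! from \<open>avg3_det3\<close> times a factor 2 from each
  pairing.\<close>

lemma alternant_orthogonal:
  assumes "a > b" "b > c"
  shows "avg3 (\<lambda>x y w. alternant s a b c x y w * alternant s 2 1 0 (1 / x) (1 / y) (1 / w))
    = 48 * of_bool (a = 2 \<and> b = 1 \<and> c = 0)"
  unfolding alternant_def avg3_det3[OF continuous_on_skew continuous_on_skew continuous_on_skew
      continuous_on_skew continuous_on_skew continuous_on_skew] pairing_skew
  using assms by (auto split: if_splits)

section \<open>Power series of the plethystic exponential\<close>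

lemma lambert_abs_summable:
  fixes c y :: "nat \<Rightarrow> complex"
  assumes "norm t < 1"
    and c: "\<And>d. norm (c d) \<le> C * real (Suc d)" and y: "\<And>n. norm (y n) \<le> B"
  shows "(\<lambda>p. norm (y (fst p) * c (snd p) * t ^ (Suc (fst p) * Suc (snd p)))) summable_on UNIV"
proof -
  have nn: "C \<ge> 0" "B \<ge> 0"
    using c[of 0] y[of 0] norm_ge_zero[of "c 0"] norm_ge_zero[of "y 0"] by linarith+
  have 1: "(\<lambda>d. real (Suc d) * norm t ^ d) summable_on UNIV"
    using geometric_deriv_sums[of "norm t"] assms(1)
    by (intro norm_summable_imp_summable_on) (simp add: norm_mult sums_summable del: of_nat_Suc)
  have 2: "(\<lambda>n. norm t ^ n) summable_on UNIV"
    using assms(1) by (intro norm_summable_imp_summable_on) (simp add: summable_geometric norm_power)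
  \<comment> \<open>The majorant comes from \<open>(n + 1) (d + 1) \<ge> n + d\<close>: it is a
    product of a geometric series and a derived geometric series.\<close>
  define m where "m p = B * C * (norm t ^ fst p * (real (Suc (snd p)) * norm t ^ snd p))" for p
  have m: "norm (m (n, d)) = m (n, d)" for n d
    using nn by (simp add: m_def abs_mult)
  have "(\<lambda>p. norm (m p)) summable_on UNIV \<times> UNIV"
    unfolding Infinite_Sum.abs_summable_on_Sigma_iff
    unfolding m
  proof (intro conjI ballI)
    show "(\<lambda>d. m (n, d)) summable_on UNIV" for n
      using summable_on_cmult_right[OF 1, of "B * C * norm t ^ n"]
      by (simp add: m_def mult.assoc)
    have "infsum (\<lambda>d. m (n, d)) UNIV
        = B * C * norm t ^ n * infsum (\<lambda>d. real (Suc d) * norm t ^ d) UNIV" for n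
      by (subst infsum_cmult_right'[symmetric]) (simp add: m_def mult.assoc)
    moreover have "infsum (\<lambda>d. real (Suc d) * norm t ^ d) UNIV \<ge> 0"
      by (rule infsum_nonneg) simp
    ultimately show "(\<lambda>n. norm (infsum (\<lambda>d. m (n, d)) UNIV)) summable_on UNIV"
      using summable_on_cmult_right[OF 2, of "B * C * infsum (\<lambda>d. real (Suc d) * norm t ^ d) UNIV"] nn
      by (simp add: abs_mult mult_ac del: of_nat_Suc)
  qed
  then have "(\<lambda>p. norm (m p)) summable_on UNIV"
    by simp
  then show ?thesis
  proof (rule Infinite_Sum.abs_summable_on_comparison_test)
    fix p :: "nat \<times> nat"
    obtain n d where p: "p = (n, d)" by (cases p)
    have "norm (y n * c d * t ^ (Suc n * Suc d)) \<le> B * (C * real (Suc d)) * norm t ^ (Suc n * Suc d)"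
      unfolding norm_mult norm_power
      using y[of n] c[of d] nn by (intro mult_mono mult_nonneg_nonneg) auto
    also have "\<dots> \<le> B * (C * real (Suc d)) * norm t ^ (n + d)"
      using assms(1) nn by (intro mult_left_mono power_decreasing mult_nonneg_nonneg) auto
    also have "\<dots> = norm (m p)"
      unfolding p m by (simp add: m_def power_add mult_ac)
    finally show "norm (y (fst p) * c (snd p) * t ^ (Suc (fst p) * Suc (snd p))) \<le> norm (m p)"
      by (simp add: p)
  qed
qed

text \<open>One absolutely convergent double series is summed in three ways: by rows, by columns,
  and along the hyperbolas where \<open>(n + 1) (d + 1) = k\<close>.\<close>

lemma lambert_sums:
  fixes c y :: "nat \<Rightarrow> complex"
  assumes t: "norm t < 1"
    and c: "\<And>d. norm (c d) \<le> C * real (Suc d)" and y: "\<And>n. norm (y n) \<le> B"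
    and g: "\<And>u. norm u < 1 \<Longrightarrow> (\<lambda>d. c d * u ^ Suc d) sums g u"
    and h: "\<And>u. norm u < 1 \<Longrightarrow> (\<lambda>n. y n * u ^ Suc n) sums h u"
  obtains s where "(\<lambda>n. y n * g (t ^ Suc n)) sums s" "(\<lambda>d. c d * h (t ^ Suc d)) sums s"
    "(\<lambda>k. (\<Sum>j | j \<in> {1..k} \<and> j dvd k. y (j - 1) * c (k div j - 1)) * t ^ k) sums s"
proof -
  define f where "f p = y (fst p) * c (snd p) * t ^ (Suc (fst p) * Suc (snd p))" for p
  have abs: "(\<lambda>p. norm (f p)) summable_on UNIV \<times> UNIV"
    using lambert_abs_summable[OF t c y] by (simp add: f_def)
  then have "f summable_on UNIV \<times> UNIV" by (rule Infinite_Sum.abs_summable_summable)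
  then obtain s where s: "(f has_sum s) (UNIV \<times> UNIV)"
    by (auto simp: summable_on_def)
  have small: "norm (t ^ Suc n) < 1" for n
    using t by (simp add: norm_power power_less_one_iff del: power_Suc)
  have slice: "(F has_sum a) UNIV" if "F summable_on UNIV" "F sums a" for F :: "nat \<Rightarrow> complex" and a
    using that by (metis has_sum_imp_sums has_sum_infsum sums_unique2)
  show thesis
  proof
    show "(\<lambda>n. y n * g (t ^ Suc n)) sums s"
    proof (rule has_sum_imp_sums, rule has_sum_Sigma[OF _ s])
      fix n
      have "(\<lambda>d. f (n, d)) summable_on UNIV"
        using abs unfolding Infinite_Sum.abs_summable_on_Sigma_iff by (auto intro: Infinite_Sum.abs_summable_summable)
      moreover have "(\<lambda>d. f (n, d)) sums (y n * g (t ^ Suc n))"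
        using sums_mult[OF g[OF small[of n]], of "y n"]
        by (simp add: f_def power_mult[symmetric] mult.assoc del: mult_Suc mult_Suc_right power_Suc)
      ultimately show "((\<lambda>d. f (n, d)) has_sum y n * g (t ^ Suc n)) UNIV" by (rule slice)
    qed (rule uniformly_continuous_add)
    have "((\<lambda>p. f (snd p, fst p)) has_sum s) (UNIV \<times> UNIV) = (f has_sum s) (UNIV \<times> UNIV)"
      by (rule has_sum_reindex_bij_witness[where i = prod.swap and j = prod.swap]) auto
    with s have swap: "((\<lambda>p. f (snd p, fst p)) has_sum s) (UNIV \<times> UNIV)" by simp
    have "(\<lambda>p. norm (f (snd p, fst p))) summable_on UNIV \<times> UNIV
        \<longleftrightarrow> (\<lambda>p. norm (f p)) summable_on UNIV \<times> UNIV"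
      by (rule summable_on_reindex_bij_witness[where i = prod.swap and j = prod.swap]) auto
    with abs have abs': "(\<lambda>p. norm (f (snd p, fst p))) summable_on UNIV \<times> UNIV" by simp
    show "(\<lambda>d. c d * h (t ^ Suc d)) sums s"
    proof (rule has_sum_imp_sums, rule has_sum_Sigma[OF _ swap])
      fix d
      have "(\<lambda>n. f (n, d)) summable_on UNIV"
        using abs' unfolding Infinite_Sum.abs_summable_on_Sigma_iff by (auto intro: Infinite_Sum.abs_summable_summable)
      moreover have "(\<lambda>n. f (n, d)) sums (c d * h (t ^ Suc d))"
        using sums_mult[OF h[OF small[of d]], of "c d"]
        by (simp add: f_def power_mult[symmetric] mult_ac del: mult_Suc mult_Suc_right power_Suc)
      ultimately show "((\<lambda>n. f (snd (d, n), fst (d, n))) has_sum c d * h (t ^ Suc d)) UNIV"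
        by (simp add: slice)
    qed (rule uniformly_continuous_add)
    let ?D = "\<lambda>k::nat. {j. j \<in> {1..k} \<and> j dvd k}"
    have "(f has_sum s) (UNIV \<times> UNIV)
        = ((\<lambda>(k, j). y (j - 1) * c (k div j - 1) * t ^ k) has_sum s) (Sigma UNIV ?D)"
      \<comment> \<open>A pair is encoded by the product \<open>k\<close> and its divisor
        \<open>j = n + 1\<close>; no pair has \<open>k = 0\<close>, in accordance with the empty
        divisor set.\<close>
      by (rule has_sum_reindex_bij_witness[where j = "\<lambda>(n, d). (Suc n * Suc d, Suc n)"
            and i = "\<lambda>(k, j). (j - 1, k div j - 1)"])
         (auto simp: f_def dvd_def simp del: mult_Suc mult_Suc_right)
    with s have "((\<lambda>(k, j). y (j - 1) * c (k div j - 1) * t ^ k) has_sum s) (Sigma UNIV ?D)"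
      by simp
    then show "(\<lambda>k. (\<Sum>j | j \<in> {1..k} \<and> j dvd k. y (j - 1) * c (k div j - 1)) * t ^ k) sums s"
      by (intro has_sum_imp_sums, elim has_sum_Sigma[rotated])
         (auto simp: sum_distrib_right uniformly_continuous_add intro!: has_sum_finiteI)
  qed
qed

text \<open>The Taylor coefficients of \<open>-(1 - t^2) / (1 - t^3)^2\<close>. They are the
  \<open>f_d\<close> for positive \<open>d\<close>, but the value at 0 is -1 where
  \<open>f_0 = 0\<close>.\<close>

definition letter :: "nat \<Rightarrow> int" where
  "letter d = (if d mod 3 = 0 then - int (d div 3 + 1) else if d mod 3 = 2 then int (d div 3 + 1) else 0)"

definition single_letter :: "complex \<Rightarrow> complex" where
  "single_letter t = 1 - (1 - t ^ 2) / (1 - t ^ 3) ^ 2"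

lemma abs_letter_le: "\<bar>letter d\<bar> \<le> int (d div 3 + 1)"
  by (simp add: letter_def)

lemma norm_letter_Suc: "norm (of_int (letter (Suc d)) :: complex) \<le> 1 * real (Suc d)"
proof -
  have "\<bar>letter (Suc d)\<bar> \<le> int (Suc d)"
    unfolding letter_def by (simp split: if_splits) linarith?
  then show ?thesis
    by (metis mult_1 norm_of_int of_int_le_iff of_int_of_nat_eq of_int_abs)
qed

lemma letter_sums:
  assumes "norm u < 1"
  shows "(\<lambda>d. of_int (letter (Suc d)) * u ^ Suc d) sums single_letter u"
proof -
  let ?f = "\<lambda>d. of_int (letter d) * u ^ d"
  have "summable (\<lambda>d. norm (of_nat (Suc d) * norm u ^ d))"
    using geometric_deriv_sums[of "norm u"] assms
    by (simp add: norm_mult sums_summable del: of_nat_Suc)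
  then have "summable ?f"
  proof (rule summable_comparison_test[rotated], intro exI allI impI)
    fix d
    have "\<bar>letter d\<bar> \<le> int (Suc d)" using abs_letter_le[of d] by linarith
    then have "real_of_int \<bar>letter d\<bar> \<le> real (Suc d)" by linarith
    then show "norm (?f d) \<le> norm (of_nat (Suc d) * norm u ^ d)"
      by (simp add: norm_mult norm_power mult_right_mono del: of_nat_Suc)
  qed
  \<comment> \<open>Three consecutive terms form one term of a derived geometric series in
    \<open>u^3\<close>; as convergence is already known, the grouped sum is the sum.\<close>
  then have "(\<lambda>n. sum ?f {n * 3..<n * 3 + 3}) sums suminf ?f"
    by (intro sums_group summable_sums) auto
  moreover have "sum ?f {n * 3..<n * 3 + 3} = - (1 - u ^ 2) * (of_nat (Suc n) * (u ^ 3) ^ n)" for n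
  proof -
    have "{n * 3..<n * 3 + 3} = {3 * n, 3 * n + 1, 3 * n + 2}" by auto
    then have "sum ?f {n * 3..<n * 3 + 3} = ?f (3 * n) + ?f (3 * n + 1) + ?f (3 * n + 2)"
      by simp
    moreover have "(3 * n + 1) mod 3 = 1" "(3 * n + 2) mod 3 = 2" "(3 * n + 2) div 3 = n"
      by presburger+
    then have "letter (3 * n) = - int (Suc n)" "letter (3 * n + 1) = 0"
      "letter (3 * n + 2) = int (Suc n)"
      unfolding letter_def by simp_all
    moreover have "u ^ (3 * n) = (u ^ 3) ^ n" "u ^ (3 * n + 2) = u ^ 2 * (u ^ 3) ^ n"
      by (simp_all add: power_add power_mult power2_eq_square)
    ultimately show ?thesis
      by (simp add: ring_distribs del: power_Suc)
  qed
  moreover have "(\<lambda>n. - (1 - u ^ 2) * (of_nat (Suc n) * (u ^ 3) ^ n))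
      sums (- (1 - u ^ 2) * (1 / (1 - u ^ 3) ^ 2))"
    using assms by (intro sums_mult geometric_deriv_sums) (simp add: norm_power power_less_one_iff)
  ultimately have "suminf ?f = - (1 - u ^ 2) * (1 / (1 - u ^ 3) ^ 2)"
    by (simp add: sums_unique2)
  with \<open>summable ?f\<close> have "?f sums (- (1 - u ^ 2) * (1 / (1 - u ^ 3) ^ 2))"
    by (metis summable_sums)
  then have "(\<lambda>d. ?f (Suc d)) sums (- (1 - u ^ 2) * (1 / (1 - u ^ 3) ^ 2) - ?f 0)"
    using sums_Suc_iff[of ?f] by (simp del: power_Suc)
  moreover have "- (1 - u ^ 2) * (1 / (1 - u ^ 3) ^ 2) - ?f 0 = single_letter u"
    by (simp add: letter_def single_letter_def diff_divide_distrib)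
  ultimately show ?thesis by simp
qed

section \<open>The plethystic exponential as a formal power series and its convergence\<close>

definition log_fps :: "(nat \<Rightarrow> complex) \<Rightarrow> complex fps" where
  "log_fps y = Abs_fps (\<lambda>k. \<Sum>j | j \<in> {1..k} \<and> j dvd k. y j / of_nat j * of_int (letter (k div j)))"

text \<open>For \<open>y n = \<chi>(z^n)\<close> the coefficients are the \<open>P_m\<close>. The
  composition behaves as substitution because \<open>log_fps y\<close> has no constant term.\<close>

definition exp_fps :: "(nat \<Rightarrow> complex) \<Rightarrow> complex fps" where
  "exp_fps y = fps_exp 1 oo log_fps y"

lemma log_fps_sums:
  assumes "norm t < 1" and y: "\<And>n. n \<ge> 1 \<Longrightarrow> norm (y n) \<le> B"
  shows "\<exists>s. (\<lambda>n. y (Suc n) / of_nat (Suc n) * single_letter (t ^ Suc n)) sums s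
    \<and> (\<lambda>k. log_fps y $ k * t ^ k) sums s"
proof -
  have y': "norm (y (Suc n) / of_nat (Suc n)) \<le> B" for n
  proof -
    have "norm (y (Suc n)) / real (Suc n) \<le> norm (y (Suc n)) / 1"
      by (intro divide_left_mono) auto
    then show ?thesis using y[of "Suc n"] by (simp add: norm_divide del: of_nat_Suc)
  qed
  have h: "(\<lambda>n. y (Suc n) / of_nat (Suc n) * u ^ Suc n) sums
      suminf (\<lambda>n. y (Suc n) / of_nat (Suc n) * u ^ Suc n)" if "norm u < 1" for u
  proof (rule summable_sums, rule summable_comparison_test[of _ "\<lambda>n. B * norm u ^ Suc n"],
      intro exI allI impI)
    show "norm (y (Suc n) / of_nat (Suc n) * u ^ Suc n) \<le> B * norm u ^ Suc n" for n
      unfolding norm_mult norm_power by (intro mult_right_mono y') simp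
    show "summable (\<lambda>n. B * norm u ^ Suc n)"
      using that by (intro summable_mult) (simp add: summable_geometric summable_Suc_iff)
  qed
  from lambert_sums[where y = "\<lambda>n. y (Suc n) / of_nat (Suc n)",
      OF assms(1) norm_letter_Suc y' letter_sums h]
  obtain s where s: "(\<lambda>n. y (Suc n) / of_nat (Suc n) * single_letter (t ^ Suc n)) sums s"
    "(\<lambda>k. (\<Sum>j | j \<in> {1..k} \<and> j dvd k. y (Suc (j - 1)) / of_nat (Suc (j - 1))
       * of_int (letter (Suc (k div j - 1)))) * t ^ k) sums s"
    by blast
  have "(\<Sum>j | j \<in> {1..k} \<and> j dvd k. y (Suc (j - 1)) / of_nat (Suc (j - 1))
       * of_int (letter (Suc (k div j - 1)))) = log_fps y $ k" for k
    unfolding log_fps_def fps_nth_Abs_fps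
    by (intro sum.cong) (auto elim!: dvdE)
  with s show ?thesis by auto
qed

lemma log_fps_nth_0: "log_fps y $ 0 = 0"
  by (simp add: log_fps_def)

lemma exp_fps_nth_0: "exp_fps y $ 0 = 1"
  by (simp add: exp_fps_def)

lemma fps_deriv_exp_fps: "fps_deriv (exp_fps y) = exp_fps y * fps_deriv (log_fps y)"
  unfolding exp_fps_def by (subst fps_compose_deriv) (simp_all add: log_fps_nth_0)

lemma exp_fps_rec_log:
  "of_nat m * exp_fps y $ m = (\<Sum>k=1..m. of_nat k * log_fps y $ k * exp_fps y $ (m - k))"
proof (cases m)
  case (Suc n)
  have "of_nat m * exp_fps y $ m = fps_deriv (exp_fps y) $ n"
    by (simp add: Suc)
  also have "\<dots> = (\<Sum>i=0..n. exp_fps y $ (n - i) * (of_nat (i + 1) * log_fps y $ (i + 1)))"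
    unfolding fps_deriv_exp_fps mult.commute[of "exp_fps y"] fps_mult_nth by (simp add: mult_ac)
  also have "\<dots> = (\<Sum>k=1..m. of_nat k * log_fps y $ k * exp_fps y $ (m - k))"
    by (rule sum.reindex_bij_witness[of _ "\<lambda>k. k - 1" Suc]) (auto simp: Suc)
  finally show ?thesis .
qed simp

text \<open>The coefficient of the logarithm is a divisor sum; writing \<open>k = j (d + 1)\<close>
  and exchanging the sums isolates \<open>y j\<close>. The bound \<open>N\<close> allows one list of
  weights for all \<open>m \<le> N\<close>, terms of too high degree being set to 0.\<close>

lemma exp_fps_rec:
  assumes "m \<le> N"
  shows "of_nat m * exp_fps y $ m = (\<Sum>j=1..m. y j * (\<Sum>d<N. of_int (int (Suc d) * letter (Suc d))
     * (if j * Suc d \<le> m then exp_fps y $ (m - j * Suc d) else 0)))"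
proof -
  let ?g = "\<lambda>d. of_int (int d * letter d) :: complex"
  have "of_nat m * exp_fps y $ m = (\<Sum>k=1..m. \<Sum>j | j \<in> {1..k} \<and> j dvd k.
      y j * ?g (k div j) * exp_fps y $ (m - k))"
    unfolding exp_fps_rec_log log_fps_def fps_nth_Abs_fps sum_distrib_left sum_distrib_right
    by (intro sum.cong refl) (auto elim!: dvdE)
  also have "\<dots> = (\<Sum>k=1..m. \<Sum>j | j \<in> {1..m} \<and> j dvd k. y j * ?g (k div j) * exp_fps y $ (m - k))"
    by (intro sum.cong refl) (auto dest: dvd_imp_le)
  also have "\<dots> = (\<Sum>j=1..m. \<Sum>k | k \<in> {1..m} \<and> j dvd k. y j * ?g (k div j) * exp_fps y $ (m - k))"
    by (rule sum.swap_restrict) auto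
  also have "\<dots> = (\<Sum>j=1..m. \<Sum>d | d \<in> {..<N} \<and> j * Suc d \<le> m.
      y j * ?g (Suc d) * exp_fps y $ (m - j * Suc d))"
  proof (rule sum.cong[OF refl])
    fix j assume j: "j \<in> {1..m}"
    show "(\<Sum>k | k \<in> {1..m} \<and> j dvd k. y j * ?g (k div j) * exp_fps y $ (m - k))
       = (\<Sum>d | d \<in> {..<N} \<and> j * Suc d \<le> m. y j * ?g (Suc d) * exp_fps y $ (m - j * Suc d))"
    proof (rule sum.reindex_bij_witness[of _ "\<lambda>d. j * Suc d" "\<lambda>k. k div j - 1"])
      fix k assume k: "k \<in> {k. k \<in> {1..m} \<and> j dvd k}"
      then obtain i where i: "k = j * i" by auto
      with k j obtain i' where i': "i = Suc i'" by (cases i) auto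
      have "i \<le> k" using i j by simp
      with k i i' j assms show "j * Suc (k div j - 1) = k"
        "k div j - 1 \<in> {d. d \<in> {..<N} \<and> j * Suc d \<le> m}"
        "y j * ?g (Suc (k div j - 1)) * exp_fps y $ (m - j * Suc (k div j - 1))
          = y j * ?g (k div j) * exp_fps y $ (m - k)"
        by auto
    qed (use j in auto)
  qed
  also have "\<dots> = (\<Sum>j=1..m. y j * (\<Sum>d<N. ?g (Suc d)
     * (if j * Suc d \<le> m then exp_fps y $ (m - j * Suc d) else 0)))"
    unfolding sum_distrib_left
    by (intro sum.cong refl sum.mono_neutral_cong_left) auto
  finally show ?thesis .
qed

text \<open>Once \<open>k\<close> times the \<open>k\<close>-th logarithmic coefficient is at most
  \<open>(8 B)^k\<close>, the recursion bounds \<open>m\<close> times the \<open>m\<close>-th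
  coefficient by \<open>m\<close> equal terms \<open>(8 B)^m\<close>.\<close>

lemma norm_exp_fps_nth:
  assumes y: "\<And>n. n \<ge> 1 \<Longrightarrow> norm (y n) \<le> B" and "B \<ge> 1"
  shows "norm (exp_fps y $ m) \<le> (8 * B) ^ m"
proof (induction m rule: less_induct)
  case (less m)
  have log: "norm (of_nat k * log_fps y $ k) \<le> (8 * B) ^ k" if "k \<ge> 1" for k
  proof -
    have "norm (of_nat k * log_fps y $ k)
        \<le> real k * (\<Sum>j | j \<in> {1..k} \<and> j dvd k. norm (y j / of_nat j * of_int (letter (k div j))))"
      unfolding log_fps_def fps_nth_Abs_fps norm_mult[of "of_nat k"] norm_of_nat
      by (intro mult_left_mono norm_sum) simp
    also have "\<dots> \<le> real k * (\<Sum>j | j \<in> {1..k} \<and> j dvd k. B * real (k + 1))"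
    proof (intro mult_left_mono sum_mono)
      fix j assume j: "j \<in> {j. j \<in> {1..k} \<and> j dvd k}"
      have "norm (y j) / real j \<le> norm (y j) / 1"
        using j by (intro divide_left_mono) auto
      then have 1: "norm (y j / of_nat j) \<le> B"
        using y[of j] j by (simp add: norm_divide)
      have "k div j div 3 \<le> k div j" "k div j \<le> k" by (rule div_le_dividend)+
      then have "\<bar>letter (k div j)\<bar> \<le> int (k + 1)"
        using abs_letter_le[of "k div j"] by linarith
      then have "real_of_int \<bar>letter (k div j)\<bar> \<le> real (k + 1)" by linarith
      with 1 show "norm (y j / of_nat j * of_int (letter (k div j))) \<le> B * real (k + 1)"
        unfolding norm_mult norm_of_int using assms(2) by (intro mult_mono) auto
    qed simp
    also have "\<dots> \<le> real k * (real k * (B * real (k + 1)))"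
    proof -
      have "card {j. j \<in> {1..k} \<and> j dvd k} \<le> card {1..k}" by (intro card_mono) auto
      then show ?thesis using assms(2) by (auto intro!: mult_left_mono mult_right_mono)
    qed
    also have "\<dots> = real k * real k * real (k + 1) * B" by simp
    \<comment> \<open>The constant 8 arises here: \<open>k\<close>, \<open>k\<close> and
      \<open>k + 1\<close> are each at most \<open>2^k\<close>.\<close>
    also have "\<dots> \<le> 2 ^ k * 2 ^ k * 2 ^ k * B ^ k"
    proof (intro mult_mono)
      show "real k \<le> 2 ^ k" using of_nat_less_two_power[of k, where 'a = real] by simp
      then show "real k \<le> 2 ^ k" .
      have "k + 1 \<le> 2 ^ k" by (metis Suc_eq_plus1 Suc_leI less_exp)
      then show "real (k + 1) \<le> 2 ^ k" by (metis of_nat_le_iff of_nat_numeral of_nat_power)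
      show "B \<le> B ^ k" using assms(2) that by (simp add: self_le_power)
    qed (use assms(2) in auto)
    also have "\<dots> = (2 * 2 * 2 * B) ^ k" by (simp only: power_mult_distrib)
    finally show ?thesis by simp
  qed
  show ?case
  proof (cases "m = 0")
    case False
    have "real m * norm (exp_fps y $ m) = norm (of_nat m * exp_fps y $ m)"
      by (simp add: norm_mult)
    also have "\<dots> \<le> (\<Sum>k=1..m. norm (of_nat k * log_fps y $ k) * norm (exp_fps y $ (m - k)))"
      unfolding exp_fps_rec_log by (intro norm_sum[THEN order_trans] sum_mono) (simp add: norm_mult)
    also have "\<dots> \<le> (\<Sum>k=1..m. (8 * B) ^ k * (8 * B) ^ (m - k))"
      using assms(2) by (intro sum_mono mult_mono log less.IH) auto
    also have "\<dots> = (\<Sum>k=1..m. (8 * B) ^ m)"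
      by (intro sum.cong refl) (simp only: power_add[symmetric] atLeastAtMost_iff le_add_diff_inverse)
    also have "\<dots> = real m * (8 * B) ^ m" by simp
    finally show ?thesis using False by simp
  qed (simp add: exp_fps_nth_0)
qed

text \<open>Passes from the formal to the analytic exponential: by the formal differential equation,
  the product of the series with \<open>exp\<close> of minus its logarithm has derivative 0 on the
  disc, and it equals 1 at the centre.\<close>

lemma exp_fps_sums:
  assumes y: "\<And>n. n \<ge> 1 \<Longrightarrow> norm (y n) \<le> B" and "B \<ge> 1" and t: "norm t < 1 / (8 * B)"
    and s: "(\<lambda>n. y (Suc n) / of_nat (Suc n) * single_letter (t ^ Suc n)) sums s"
  shows "(\<lambda>m. exp_fps y $ m * t ^ m) sums exp s"
proof -
  have log_sums: "\<exists>s. (\<lambda>n. y (Suc n) / of_nat (Suc n) * single_letter (u ^ Suc n)) sums s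
    \<and> (\<lambda>k. log_fps y $ k * u ^ k) sums s" if "norm u < 1" for u
    using that y by (rule log_fps_sums)
  define R where "R = 1 / (8 * B)"
  have R: "0 < R" "R \<le> 1" using assms(2) by (auto simp: R_def field_simps)
  have radE: "fps_conv_radius (exp_fps y) \<ge> ereal R"
    unfolding fps_conv_radius_def
  proof (rule conv_radius_geI_ex')
    fix r assume r: "0 < r" "ereal r < ereal R"
    show "summable (\<lambda>m. exp_fps y $ m * of_real r ^ m)"
    proof (rule summable_comparison_test, intro exI allI impI)
      show "norm (exp_fps y $ m * of_real r ^ m) \<le> (8 * B * r) ^ m" for m
        unfolding norm_mult norm_power power_mult_distrib[of "8 * B"]
        using r assms(2) by (intro mult_mono norm_exp_fps_nth y assms) auto
      show "summable (\<lambda>m. (8 * B * r) ^ m)"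
        using r assms(2) by (intro summable_geometric) (auto simp: R_def field_simps)
    qed
  qed
  have radL: "fps_conv_radius (log_fps y) \<ge> ereal R"
    unfolding fps_conv_radius_def
  proof (rule conv_radius_geI_ex')
    fix r assume r: "0 < r" "ereal r < ereal R"
    then have "norm (of_real r :: complex) < 1" using R by simp
    from log_sums[OF this] show "summable (\<lambda>m. log_fps y $ m * of_real r ^ m)"
      by (elim exE conjE sums_summable)
  qed
  let ?h = "\<lambda>z. eval_fps (exp_fps y) z * exp (- eval_fps (log_fps y) z)"
  have in_ball: "ereal (norm z) < fps_conv_radius (exp_fps y)" "ereal (norm z) < fps_conv_radius (log_fps y)"
    if "norm z < R" for z
    using that radE radL by (auto intro: less_le_trans[of _ "ereal R"])
  have "(?h has_field_derivative 0) (at z)" if z: "norm z < R" for z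
  proof -
    have "(?h has_field_derivative
        eval_fps (exp_fps y) z * (exp (- eval_fps (log_fps y) z) * - eval_fps (fps_deriv (log_fps y)) z)
        + eval_fps (fps_deriv (exp_fps y)) z * exp (- eval_fps (log_fps y) z)) (at z)"
      using in_ball[OF z] by (auto intro!: derivative_eq_intros has_field_derivative_eval_fps)
    moreover have "eval_fps (fps_deriv (exp_fps y)) z
        = eval_fps (exp_fps y) z * eval_fps (fps_deriv (log_fps y)) z"
      unfolding fps_deriv_exp_fps using in_ball[OF z] fps_conv_radius_deriv[of "log_fps y"]
      by (intro eval_fps_mult) (auto intro: less_le_trans)
    ultimately show ?thesis by (simp add: algebra_simps)
  qed
  then have "\<exists>c. \<forall>z\<in>ball 0 R. ?h z = c"
    by (intro has_field_derivative_zero_constant)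
       (auto simp: dist_norm intro: has_field_derivative_at_within)
  then have "?h t = ?h 0"
    using t R by (auto simp: R_def dist_norm)
  then have "eval_fps (exp_fps y) t = exp (eval_fps (log_fps y) t)"
    by (simp add: eval_fps_at_0 exp_fps_nth_0 log_fps_nth_0 exp_minus field_simps)
  moreover have "eval_fps (log_fps y) t = s"
  proof -
    have "norm t < 1" using t R unfolding R_def by linarith
    from log_sums[OF this]
    obtain s' where "(\<lambda>n. y (Suc n) / of_nat (Suc n) * single_letter (t ^ Suc n)) sums s'"
      and s': "(\<lambda>k. log_fps y $ k * t ^ k) sums s'"
      by (elim exE conjE)
    with s have "s' = s" by (intro sums_unique2)
    with s' have "(\<lambda>k. log_fps y $ k * t ^ k) sums s" by simp
    then show ?thesis by (simp add: eval_fps_def sums_iff)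
  qed
  moreover have "(\<lambda>m. exp_fps y $ m * t ^ m) sums eval_fps (exp_fps y) t"
    using in_ball[of t] t by (intro sums_eval_fps) (auto simp: R_def)
  ultimately show ?thesis by simp
qed

section \<open>The Weyl density and the index\<close>

text \<open>Roots have modulus 1 on the torus, so the logarithm is needed on the boundary of the
  unit disc. The remainder after \<open>N\<close> terms is at most
  \<open>1 / (\<delta> (N + 1))\<close>, where \<open>\<delta>\<close> is the distance from 1 to the
  radius ending at \<open>w\<close>.\<close>

lemma log_series_circle:
  assumes w: "norm w = 1" "w \<noteq> 1"
  shows "(\<lambda>n. w ^ Suc n / of_nat (Suc n)) sums (- Ln (1 - w))"
proof -
  have "(Re w) ^ 2 + (Im w) ^ 2 = 1"
    using w(1) cmod_power2[of w] by simp
  moreover have "Re w = 1 \<Longrightarrow> Im w \<noteq> 0" using w(2) by (auto simp: complex_eq_iff)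
  ultimately have "Re w < 1"
    using abs_Re_le_cmod[of w] w(1) by (cases "Re w = 1") auto
  \<comment> \<open>This keeps \<open>1 - u w\<close> in the right half plane, away from 0 and from
    the branch cut of \<open>Ln\<close>.\<close>
  then have Re: "Re (of_real u * w) < 1" if "u \<in> {0..1}" for u :: real
    using that mult_left_le_one_le[of "Re w" u] mult_nonneg_nonpos[of u "Re w"]
    by (cases "Re w \<ge> 0") auto
  define d where "d u = norm (1 - of_real u * w)" for u :: real
  have "continuous_on {0..1} d"
    unfolding d_def by (intro continuous_intros)
  then obtain u0 where u0: "u0 \<in> {0..1}" "\<And>u. u \<in> {0..1} \<Longrightarrow> d u0 \<le> d u"
    using continuous_attains_inf[of "{0..1}" d] by auto
  define \<delta> where "\<delta> = d u0"
  have "of_real u0 * w \<noteq> 1" using Re[OF u0(1)] by (metis less_irrefl one_complex.sel(1))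
  then have \<delta>: "\<delta> > 0" by (simp add: \<delta>_def d_def)
  define H where "H N z = (\<Sum>n<N. (z * w) ^ Suc n / of_nat (Suc n)) + Ln (1 - z * w)" for N z
  txt \<open>The remainder \<open>H N 1\<close> is the integral of its derivative along the radius from 0 to \<open>w\<close>.\<close>
  have bound: "norm (H N 1) \<le> 1 / \<delta> * (1 / real (Suc N))" for N
  proof -
    define h where "h u = - (w * (of_real u * w) ^ N / (1 - of_real u * w))" for u :: real
    have "(H N has_field_derivative h u) (at (of_real u))" if u: "u \<in> {0..1}" for u
    proof -
      have nz: "1 - of_real u * w \<noteq> 0" "1 - of_real u * w \<notin> \<real>\<^sub>\<le>\<^sub>0"
        using Re[OF u] by (auto simp: complex_nonpos_Reals_iff complex_eq_iff)
      have d: "((\<lambda>z. (z * w) ^ Suc n / of_nat (Suc n)) has_field_derivative w * (of_real u * w) ^ n)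
          (at (of_real u))" for n
        using DERIV_cdivide[OF DERIV_power[OF DERIV_cmult_right[OF DERIV_ident, of w], of "Suc n"],
            of "of_nat (Suc n)"]
        by (simp del: of_nat_Suc power_Suc)
      have "((\<lambda>z. Ln (1 - z * w)) has_field_derivative inverse (1 - of_real u * w) * (0 - w))
          (at (of_real u))"
        using nz by (auto intro!: derivative_eq_intros)
      then have "(H N has_field_derivative (\<Sum>n<N. w * (of_real u * w) ^ n)
          + inverse (1 - of_real u * w) * (0 - w)) (at (of_real u))"
        unfolding H_def by (intro DERIV_add DERIV_sum d)
      moreover have "(\<Sum>n<N. w * (of_real u * w) ^ n)
          = w * ((1 - (of_real u * w) ^ N) / (1 - of_real u * w))"
        using nz by (simp add: sum_distrib_left[symmetric] sum_gp_strict)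
      moreover have "w * ((1 - (of_real u * w) ^ N) / (1 - of_real u * w))
          + inverse (1 - of_real u * w) * (0 - w) = h u"
        by (simp add: h_def diff_divide_distrib right_diff_distrib inverse_eq_divide)
      ultimately show ?thesis by simp
    qed
    then have "((\<lambda>u. H N (of_real u)) has_vector_derivative h u) (at u within {0..1})"
      if "u \<in> {0..1}" for u
      using that by (intro has_vector_derivative_real_field)
    then have int: "(h has_integral (H N (of_real 1) - H N (of_real 0))) {0..1}"
      by (intro fundamental_theorem_of_calculus) auto
    have "((\<lambda>u. 1 / \<delta> * u ^ N) has_integral
        (1 / \<delta> * (1 ^ Suc N / real (Suc N)) - 1 / \<delta> * (0 ^ Suc N / real (Suc N)))) {0..1}"
    proof (intro fundamental_theorem_of_calculus)
      show "((\<lambda>u. 1 / \<delta> * (u ^ Suc N / real (Suc N))) has_vector_derivative 1 / \<delta> * u ^ N)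
          (at u within {0..1})" for u
        unfolding has_real_derivative_iff_has_vector_derivative[symmetric]
        using DERIV_cmult[OF DERIV_cdivide[OF DERIV_power[OF DERIV_ident, of "Suc N"],
            of "real (Suc N)"], of "1 / \<delta>"]
        by (simp del: of_nat_Suc power_Suc)
    qed simp
    then have int': "((\<lambda>u. 1 / \<delta> * u ^ N) has_integral 1 / \<delta> * (1 / real (Suc N))) {0..1}"
      by simp
    have "norm (h u) \<le> 1 / \<delta> * u ^ N" if "u \<in> {0..1}" for u
      using that u0(2)[OF that] \<delta> w(1)
      by (simp add: h_def norm_divide norm_mult norm_power \<delta>_def d_def frac_le)
    then have "norm (integral {0..1} h) \<le> integral {0..1} (\<lambda>u. 1 / \<delta> * u ^ N)"
      using int int' by (intro integral_norm_bound_integral) auto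
    then show ?thesis
      using integral_unique[OF int] integral_unique[OF int'] by (simp add: H_def)
  qed
  have "(\<lambda>N. 1 / \<delta> * (1 / real (Suc N))) \<longlonglongrightarrow> 1 / \<delta> * 0"
    by (intro tendsto_intros LIMSEQ_inverse_real_of_nat[unfolded inverse_eq_divide])
  then have "(\<lambda>N. 1 / \<delta> * (1 / real (Suc N))) \<longlonglongrightarrow> 0"
    by (simp only: mult_zero_right)
  then have "(\<lambda>N. H N 1) \<longlonglongrightarrow> 0"
    by (rule Lim_null_comparison[OF always_eventually[OF allI[OF bound]]])
  then have "(\<lambda>N. H N 1 - Ln (1 - w)) \<longlonglongrightarrow> 0 - Ln (1 - w)"
    by (intro tendsto_intros)
  then show ?thesis
    by (simp add: sums_def H_def)
qed

section \<open>The Weyl denominator formula\<close>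

definition nonzero_roots :: "bool \<Rightarrow> complex \<Rightarrow> complex \<Rightarrow> complex \<Rightarrow> complex list" where
  "nonzero_roots s x y w =
     [x / y, y / x, x * y, 1 / (x * y), x / w, w / x, x * w, 1 / (x * w), y / w, w / y, y * w, 1 / (y * w),
      x ^ stretch s 1, 1 / x ^ stretch s 1, y ^ stretch s 1, 1 / y ^ stretch s 1,
      w ^ stretch s 1, 1 / w ^ stretch s 1]"

definition weyl_density :: "bool \<Rightarrow> complex \<Rightarrow> complex \<Rightarrow> complex \<Rightarrow> complex" where
  "weyl_density s x y w = (\<Prod>r\<leftarrow>nonzero_roots s x y w. 1 - r)"

lemma power_sum_nonzero_roots:
  assumes "x \<noteq> 0" "y \<noteq> 0" "w \<noteq> 0"
  shows "(\<Sum>r\<leftarrow>nonzero_roots s x y w. r ^ n) = adj_char s n x y w - 3"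
proof -
  have pair: "pow_sum n u * pow_sum n v = (u / v) ^ n + (v / u) ^ n + (u * v) ^ n + (1 / (u * v)) ^ n"
    if "u \<noteq> 0" "v \<noteq> 0" for u v
    using that by (simp add: pow_sum_def power_divide power_mult_distrib field_simps)
  have "stretch s n = stretch s 1 * n" by (cases s) auto
  then have single: "pow_sum (stretch s n) u = (u ^ stretch s 1) ^ n + (1 / u ^ stretch s 1) ^ n" for u
    by (simp add: pow_sum_def power_mult power_one_over)
  show ?thesis
    unfolding nonzero_roots_def adj_char_def pair[OF assms(1,2)] pair[OF assms(1,3)]
      pair[OF assms(2,3)] single
    by simp
qed

text \<open>The alternant of \<rho> is a product of three functions \<open>skew s 0\<close> and the
  Vandermonde determinant in \<open>x + 1 / x\<close>, \<open>y + 1 / y\<close>,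
  \<open>w + 1 / w\<close>. Inversion fixes these variables, so the Vandermonde determinant gets
  squared, and each squared difference is the product over four roots.\<close>

lemma weyl_density_alternant:
  assumes "x \<noteq> 0" "y \<noteq> 0" "w \<noteq> 0"
  shows "weyl_density s x y w
    = alternant s 2 1 0 x y w * alternant s 2 1 0 (1 / x) (1 / y) (1 / w)"
proof -
  \<comment> \<open>The two groups differ only in this term: 1 for \<open>SO(7)\<close>, 0 for
    \<open>Sp(3)\<close>.\<close>
  define e :: complex where "e = of_bool (\<not> s)"
  have S1: "skew s 1 z = skew s 0 z * (z + 1 / z + e)"
    and S2: "skew s 2 z = skew s 0 z * ((z + 1 / z) ^ 2 + e * (z + 1 / z) - 1)" if "z \<noteq> 0" for z
    using that
    by (cases s; simp add: skew_def e_def field_simps power2_eq_square power3_eq_cube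
      power_int_minus numeral_eq_Suc)+
  have S0: "skew s 0 z * skew s 0 (1 / z) = (1 - z ^ stretch s 1) * (1 - 1 / z ^ stretch s 1)"
    if "z \<noteq> 0" for z
    using that by (cases s) (auto simp: skew_def field_simps power2_eq_square power_int_minus)
  have pair: "(1 - u / v) * (1 - v / u) * (1 - u * v) * (1 - 1 / (u * v)) = ((u + 1 / u) - (v + 1 / v)) ^ 2"
    if "u \<noteq> 0" "v \<noteq> 0" for u v :: complex
    using that by (simp add: field_simps power2_eq_square)
  \<comment> \<open>Terms of lower degree drop out by column operations, leaving the Vandermonde
    determinant for either value of \<open>e\<close>.\<close>
  have vandermonde: "a * (X ^ 2 + e * X - 1) * (b * (Y + e)) * c
      - a * (X ^ 2 + e * X - 1) * b * (c * (W + e)) - a * (X + e) * (b * (Y ^ 2 + e * Y - 1)) * c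
      + a * (X + e) * b * (c * (W ^ 2 + e * W - 1)) + a * (b * (Y ^ 2 + e * Y - 1)) * (c * (W + e))
      - a * (b * (Y + e)) * (c * (W ^ 2 + e * W - 1))
    = a * b * c * ((X - Y) * (X - W) * (Y - W))" for a b c X Y W :: complex
    by algebra
  have A: "alternant s 2 1 0 x y w = skew s 0 x * skew s 0 y * skew s 0 w
      * (((x + 1 / x) - (y + 1 / y)) * ((x + 1 / x) - (w + 1 / w)) * ((y + 1 / y) - (w + 1 / w)))"
    if "x \<noteq> 0" "y \<noteq> 0" "w \<noteq> 0" for x y w
    unfolding alternant_def det3_def using S1 S2 that by (simp add: vandermonde)
  have den: "weyl_density s x y w =
      ((1 - x / y) * (1 - y / x) * (1 - x * y) * (1 - 1 / (x * y)))
      * ((1 - x / w) * (1 - w / x) * (1 - x * w) * (1 - 1 / (x * w)))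
      * ((1 - y / w) * (1 - w / y) * (1 - y * w) * (1 - 1 / (y * w)))
      * ((1 - x ^ stretch s 1) * (1 - 1 / x ^ stretch s 1))
      * ((1 - y ^ stretch s 1) * (1 - 1 / y ^ stretch s 1))
      * ((1 - w ^ stretch s 1) * (1 - 1 / w ^ stretch s 1))"
    by (simp add: weyl_density_def nonzero_roots_def mult.assoc)
  have inv: "1 / x \<noteq> 0" "1 / y \<noteq> 0" "1 / w \<noteq> 0" "1 / x + 1 / (1 / x) = x + 1 / x"
    "1 / y + 1 / (1 / y) = y + 1 / y" "1 / w + 1 / (1 / w) = w + 1 / w"
    using assms by simp_all
  show ?thesis
    unfolding den pair[OF assms(1,2)] pair[OF assms(1,3)] pair[OF assms(2,3)]
      S0[OF assms(1), symmetric] S0[OF assms(2), symmetric] S0[OF assms(3), symmetric]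
      A[OF assms] A[OF inv(1-3)] inv(4-6)
    by algebra
qed

section \<open>Termwise integration and evaluation of the index factors\<close>

lemma avg3_sums:
  assumes cont: "\<And>m. cont3 (F m)"
    and bound: "\<And>m x y w. \<lbrakk>x \<in> circ; y \<in> circ; w \<in> circ\<rbrakk> \<Longrightarrow> norm (F m x y w) \<le> M m"
    and M: "summable M"
    and sums: "\<And>x y w. \<lbrakk>x \<in> circ; y \<in> circ; w \<in> circ\<rbrakk> \<Longrightarrow> (\<lambda>m. F m x y w) sums G x y w"
  shows "(\<lambda>m. avg3 (F m)) sums avg3 G"
proof -
  let ?T = "circ \<times> circ \<times> circ"
  have "uniform_limit ?T (\<lambda>n p. \<Sum>m<n. case p of (x, y, w) \<Rightarrow> F m x y w)
      (\<lambda>p. suminf (\<lambda>m. case p of (x, y, w) \<Rightarrow> F m x y w)) sequentially"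
    by (rule Weierstrass_m_test[OF _ M]) (use bound in auto)
  moreover have "suminf (\<lambda>m. case p of (x, y, w) \<Rightarrow> F m x y w) = (case p of (x, y, w) \<Rightarrow> G x y w)"
    if "p \<in> ?T" for p
    using that sums by (auto simp: sums_iff)
  ultimately have lim: "uniform_limit ?T (\<lambda>n p. \<Sum>m<n. case p of (x, y, w) \<Rightarrow> F m x y w)
      (\<lambda>p. case p of (x, y, w) \<Rightarrow> G x y w) sequentially"
    by (simp cong: uniform_limit_cong')
  have cont_part: "cont3 (\<lambda>x y w. \<Sum>m<n. F m x y w)" for n
    using cont by (rule cont3_sum)
  have "cont3 G"
    unfolding cont3_def
    by (rule uniform_limit_theorem[OF _ lim])
       (use cont_part in \<open>auto simp: cont3_def case_prod_beta\<close>)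
  have "(\<lambda>n. avg3 (\<lambda>x y w. \<Sum>m<n. F m x y w)) \<longlonglongrightarrow> avg3 G"
  proof (rule LIMSEQ_I)
    fix r :: real assume "0 < r"
    then have "\<forall>\<^sub>F n in sequentially. \<forall>p\<in>?T.
        dist (\<Sum>m<n. case p of (x, y, w) \<Rightarrow> F m x y w) (case p of (x, y, w) \<Rightarrow> G x y w) < r / 2"
      by (intro uniform_limitD[OF lim]) simp
    then obtain N where N: "\<And>n x y w. \<lbrakk>N \<le> n; x \<in> circ; y \<in> circ; w \<in> circ\<rbrakk> \<Longrightarrow>
        norm ((\<Sum>m<n. F m x y w) - G x y w) < r / 2"
      by (force simp: eventually_sequentially dist_norm)
    have "norm (avg3 (\<lambda>x y w. \<Sum>m<n. F m x y w) - avg3 G) < r" if "N \<le> n" for n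
    proof -
      have "norm (avg3 (\<lambda>x y w. (\<Sum>m<n. F m x y w) - G x y w)) \<le> r / 2"
        using N[OF that] \<open>cont3 G\<close> cont_part
        by (intro avg3_norm_le cont3_diff) (auto intro: less_imp_le)
      then show ?thesis
        using \<open>0 < r\<close> by (simp add: avg3_diff[OF cont_part \<open>cont3 G\<close>])
    qed
    then show "\<exists>N. \<forall>n\<ge>N. norm (avg3 (\<lambda>x y w. \<Sum>m<n. F m x y w) - avg3 G) < r" by blast
  qed
  then show ?thesis
    by (simp add: sums_def avg3_sum cont)
qed

lemma has_fps_expansion_if_sums:
  fixes f :: "complex \<Rightarrow> complex"
  assumes "0 < r" "\<And>t. norm t < r \<Longrightarrow> (\<lambda>m. c m * t ^ m) sums f t"
  shows "f has_fps_expansion Abs_fps c"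
proof -
  have "fps_conv_radius (Abs_fps c) \<ge> ereal r"
    unfolding fps_conv_radius_def
  proof (rule conv_radius_geI_ex')
    fix u assume "0 < u" "ereal u < ereal r"
    then have "norm (of_real u :: complex) < r" by simp
    from assms(2)[OF this] show "summable (\<lambda>n. fps_nth (Abs_fps c) n * of_real u ^ n)"
      by (simp add: sums_summable)
  qed
  then have "0 < fps_conv_radius (Abs_fps c)"
    using assms(1) by (auto intro: less_le_trans[of _ "ereal r"])
  moreover have "\<forall>\<^sub>F t in nhds 0. t \<in> ball 0 r"
    using assms(1) by (intro eventually_nhds_in_open) auto
  then have "\<forall>\<^sub>F t in nhds 0. eval_fps (Abs_fps c) t = f t"
    by eventually_elim (use assms(2) in \<open>auto simp: eval_fps_def sums_iff dist_norm\<close>)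
  ultimately show ?thesis
    by (simp add: has_fps_expansion_def)
qed

text \<open>The logarithm of the product is a double series over factors and powers; summing first
  over the factors gives the stated Lambert series.\<close>

lemma qpoch_inf_eq_exp:
  assumes "norm x < 1"
  obtains s where "(\<lambda>n. 1 / of_nat (Suc n) * (x ^ Suc n / (1 - x ^ Suc n))) sums s"
    "qpoch_inf x = exp (- s)"
proof -
  have small: "norm (u ^ Suc n) < 1" if "norm u < 1" for u :: complex and n
    using that by (simp add: norm_power power_less_one_iff del: power_Suc)
  have g: "(\<lambda>d. 1 * u ^ Suc d) sums (u / (1 - u))" if "norm u < 1" for u :: complex
    using sums_mult[OF geometric_sums[OF that], of u] by simp
  have h: "(\<lambda>n. 1 / of_nat (Suc n) * u ^ Suc n) sums (- Ln (1 - u))" if "norm u < 1" for u :: complex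
  proof -
    have "(\<lambda>n. - ((- (- u)) ^ n) / of_nat n) sums ln (1 + - u)"
      by (rule Ln_series') (use that in simp)
    then have "(\<lambda>n. - (u ^ Suc n / of_nat (Suc n))) sums Ln (1 - u)"
      using sums_Suc_iff[of "\<lambda>n. - ((- (- u)) ^ n) / of_nat n" "Ln (1 - u)"]
      by (simp del: of_nat_Suc power_Suc)
    from sums_minus[OF this] show ?thesis by simp
  qed
  have "norm (1 :: complex) \<le> 1 * real (Suc d)" "norm (1 / of_nat (Suc n) :: complex) \<le> 1" for n d
    by (simp_all add: norm_divide del: of_nat_Suc)
  from lambert_sums[where y = "\<lambda>n. 1 / of_nat (Suc n)" and c = "\<lambda>_. 1", OF assms this g h]
  obtain s where s: "(\<lambda>n. 1 / of_nat (Suc n) * (x ^ Suc n / (1 - x ^ Suc n))) sums s"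
    "(\<lambda>d. 1 * - Ln (1 - x ^ Suc d)) sums s"
    by blast
  from sums_minus[OF s(2)] have "(\<lambda>d. Ln (1 - x ^ Suc d)) sums (- s)" by simp
  then have "(\<Prod>d. exp (Ln (1 - x ^ Suc d))) = exp (- s)"
    by (simp add: prodinf_exp sums_iff)
  moreover have "exp (Ln (1 - x ^ Suc d)) = 1 - x ^ Suc d" for d
    using small[OF assms, of d] by (intro exp_Ln) auto
  ultimately have "qpoch_inf x = exp (- s)"
    by (simp add: qpoch_inf_def)
  with s(1) show thesis by (rule that)
qed

text \<open>With \<open>p = q = v\<close>, the identity
  \<open>(a - v^2) / (1 - v)^2 = f + 2 v / (1 - v)\<close> shows that the two q-Pochhammer factors
  cancel the last term. Each Cartan direction contributes the plethystic exponential of the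
  single-letter index.\<close>

lemma prefactor_eq_exp:
  assumes "norm t < 1" and s: "(\<lambda>n. 1 / of_nat (Suc n) * single_letter (t ^ Suc n)) sums s"
  shows "qpoch_inf (t ^ 3) ^ N * qpoch_inf (t ^ 3) ^ N
    * PE (\<lambda>a p q z. (a - p * q) / ((1 - p) * (1 - q))) (t ^ 2) (t ^ 3) (t ^ 3) (\<lambda>_. 1) ^ N
    = exp (of_nat N * s)"
proof -
  have t3: "norm (t ^ 3) < 1" using assms(1) by (simp add: norm_power power_less_one_iff)
  then obtain s' where s': "(\<lambda>n. 1 / of_nat (Suc n) * ((t ^ 3) ^ Suc n / (1 - (t ^ 3) ^ Suc n))) sums s'"
    and q: "qpoch_inf (t ^ 3) = exp (- s')"
    by (rule qpoch_inf_eq_exp)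
  have "((t ^ 2) ^ Suc n - (t ^ 3) ^ Suc n * (t ^ 3) ^ Suc n)
      / ((1 - (t ^ 3) ^ Suc n) * (1 - (t ^ 3) ^ Suc n)) / of_nat (Suc n)
    = 1 / of_nat (Suc n) * single_letter (t ^ Suc n)
      + 2 * (1 / of_nat (Suc n) * ((t ^ 3) ^ Suc n / (1 - (t ^ 3) ^ Suc n)))" for n
  proof -
    define v where "v = (t ^ 3) ^ Suc n"
    define a where "a = (t ^ 2) ^ Suc n"
    have "norm v < 1" unfolding v_def using t3 by (simp add: norm_power power_less_one_iff del: power_Suc)
    then have "1 - v \<noteq> 0" by auto
    moreover have "single_letter (t ^ Suc n) = 1 - (1 - a) / (1 - v) ^ 2"
      unfolding single_letter_def v_def a_def by (simp only: power_mult[symmetric] mult.commute)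
    ultimately have "(a - v * v) / ((1 - v) * (1 - v)) = single_letter (t ^ Suc n) + 2 * (v / (1 - v))"
      by (simp add: divide_simps power2_eq_square) algebra
    then show ?thesis
      unfolding v_def[symmetric] a_def[symmetric]
      by (simp add: add_divide_distrib del: of_nat_Suc power_Suc)
  qed
  with sums_add[OF s sums_mult[OF s', of 2]]
  have "PE (\<lambda>a p q z. (a - p * q) / ((1 - p) * (1 - q))) (t ^ 2) (t ^ 3) (t ^ 3) (\<lambda>_. 1) = exp (s + 2 * s')"
    unfolding PE_def by (simp only: sums_iff)
  then show ?thesis
    by (simp add: q exp_of_nat_mult[symmetric] exp_add[symmetric] algebra_simps)
qed

text \<open>The factor \<open>(a - 1) / ((1 - p) (1 - q))\<close> is the single-letter index minus
  1. The -1 turns each root \<open>r\<close> into the logarithm of \<open>1 - r\<close>, which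
  produces the Weyl density; the rest gives \<open>exp s\<close>.\<close>

lemma PE_roots_eq:
  assumes "norm t < 1" and circ: "x \<in> circ" "y \<in> circ" "w \<in> circ"
    and ne: "1 \<notin> set (nonzero_roots b x y w)"
    and R: "\<And>n. R (\<lambda>i. z i ^ n) = adj_char b n x y w - 3"
    and s: "(\<lambda>n. (adj_char b (Suc n) x y w - 3) / of_nat (Suc n) * single_letter (t ^ Suc n)) sums s"
  shows "PE (\<lambda>a p q z. (a - 1) / ((1 - p) * (1 - q)) * R z) (t ^ 2) (t ^ 3) (t ^ 3) z
    = weyl_density b x y w * exp s"
proof -
  have nz: "x \<noteq> 0" "y \<noteq> 0" "w \<noteq> 0" using circ by auto
  have norm1: "norm r = 1" if "r \<in> set (nonzero_roots b x y w)" for r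
    using that circ by (auto simp: nonzero_roots_def norm_divide norm_mult norm_power)
  have log: "(\<lambda>n. \<Sum>r\<leftarrow>rs. r ^ Suc n / of_nat (Suc n)) sums (\<Sum>r\<leftarrow>rs. - Ln (1 - r))"
    if "\<And>r. r \<in> set rs \<Longrightarrow> norm r = 1 \<and> r \<noteq> 1" for rs :: "complex list"
    using that
  proof (induction rs)
    case (Cons r rs)
    then have "(\<lambda>n. r ^ Suc n / of_nat (Suc n)) sums - Ln (1 - r)"
      by (intro log_series_circle) auto
    with Cons show ?case
      unfolding list.map sum_list.Cons by (intro sums_add Cons.IH) auto
  qed simp
  have exp_log: "exp (\<Sum>r\<leftarrow>rs. Ln (1 - r)) = (\<Prod>r\<leftarrow>rs. 1 - r)"
    if "1 \<notin> set rs" for rs :: "complex list"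
    using that by (induction rs) (auto simp: exp_add)
  let ?L = "\<Sum>r\<leftarrow>nonzero_roots b x y w. - Ln (1 - r)"
  have "(\<lambda>n. \<Sum>r\<leftarrow>nonzero_roots b x y w. r ^ Suc n / of_nat (Suc n)) sums ?L"
    using norm1 ne by (intro log) auto
  moreover have "(\<Sum>r\<leftarrow>nonzero_roots b x y w. r ^ Suc n / of_nat (Suc n))
      = (adj_char b (Suc n) x y w - 3) / of_nat (Suc n)" for n
    unfolding power_sum_nonzero_roots[OF nz, symmetric]
    by (simp only: divide_inverse sum_list_mult_const)
  ultimately have L: "(\<lambda>n. (adj_char b (Suc n) x y w - 3) / of_nat (Suc n)) sums ?L" by simp
  have "((t ^ 2) ^ Suc n - 1) / ((1 - (t ^ 3) ^ Suc n) * (1 - (t ^ 3) ^ Suc n)) * R (\<lambda>i. z i ^ Suc n)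
      / of_nat (Suc n)
    = (adj_char b (Suc n) x y w - 3) / of_nat (Suc n) * single_letter (t ^ Suc n)
      - (adj_char b (Suc n) x y w - 3) / of_nat (Suc n)" for n
  proof -
    have "single_letter (t ^ Suc n)
      = 1 + ((t ^ 2) ^ Suc n - 1) / ((1 - (t ^ 3) ^ Suc n) * (1 - (t ^ 3) ^ Suc n))"
      unfolding single_letter_def power2_eq_square[of "1 - _"]
      by (simp only: power_mult[symmetric] mult.commute) (simp add: diff_divide_distrib)
    then show ?thesis
      unfolding R by (simp add: algebra_simps del: of_nat_Suc power_Suc)
  qed
  with sums_diff[OF s L] have "PE (\<lambda>a p q z. (a - 1) / ((1 - p) * (1 - q)) * R z) (t ^ 2) (t ^ 3) (t ^ 3) z
    = exp (s - ?L)"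
    unfolding PE_def by (simp only: sums_iff)
  also have "s - ?L = s + (\<Sum>r\<leftarrow>nonzero_roots b x y w. Ln (1 - r))"
    by (simp add: uminus_sum_list_map o_def)
  also have "exp \<dots> = weyl_density b x y w * exp s"
    by (simp add: exp_add exp_log[OF ne] weyl_density_def)
  finally show ?thesis .
qed

section \<open>Uniform bounds and continuity on the torus\<close>

lemma continuous_on_pow_sum: "continuous_on circ (pow_sum n)"
  unfolding pow_sum_def by (auto intro!: continuous_intros)

lemma cont3_adj_char: "cont3 (adj_char s n)"
  unfolding adj_char_def
  by (intro cont3_add cont3_mult cont3_const cont3_coord continuous_on_pow_sum)

text \<open>The bound is the common dimension of the two groups, 3 + 12 + 6.\<close>

lemma norm_adj_char:
  assumes "x \<in> circ" "y \<in> circ" "w \<in> circ"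
  shows "norm (adj_char s n x y w) \<le> 21"
proof -
  have 1: "norm (pow_sum k u) \<le> 2" if "u \<in> circ" for k u
    using that norm_triangle_ineq[of "u ^ k" "1 / u ^ k"]
    by (simp add: pow_sum_def norm_divide norm_power)
  have 2: "norm (pow_sum k u * pow_sum k v) \<le> 4" if "u \<in> circ" "v \<in> circ" for k u v
    using mult_mono[OF 1[OF that(1), of k] 1[OF that(2), of k]] by (simp add: norm_mult)
  note bounds = 1[OF assms(1), of "stretch s n"] 1[OF assms(2), of "stretch s n"]
    1[OF assms(3), of "stretch s n"] 2[OF assms(1,2), of n] 2[OF assms(1,3), of n] 2[OF assms(2,3), of n]
  have 3: "norm (a + b + c) \<le> norm a + norm b + norm c" for a b c :: complex
    by (metis add_right_mono norm_triangle_ineq order_trans)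
  show ?thesis
    unfolding adj_char_def using bounds
    by (intro order_trans[OF 3] order_trans[OF add_mono[OF add_mono[OF order_refl 3] 3]]) simp
qed

text \<open>The recursion makes each coefficient a polynomial in finitely many characters.\<close>

lemma cont3_exp_fps: "cont3 (\<lambda>x y w. exp_fps (\<lambda>n. adj_char s n x y w) $ m)"
proof (induction m rule: less_induct)
  case (less m)
  show ?case
  proof (cases "m = 0")
    case False
    have "exp_fps y $ m
        = (\<Sum>k=1..m. (\<Sum>j | j \<in> {1..k} \<and> j dvd k. y j * (of_nat k * of_int (letter (k div j)) / (of_nat j * of_nat m)))
          * exp_fps y $ (m - k))" for y
    proof -
      have "of_nat m * exp_fps y $ m = of_nat m * (\<Sum>k=1..m.
          (\<Sum>j | j \<in> {1..k} \<and> j dvd k. y j * (of_nat k * of_int (letter (k div j)) / (of_nat j * of_nat m)))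
          * exp_fps y $ (m - k))"
        unfolding exp_fps_rec_log log_fps_def fps_nth_Abs_fps sum_distrib_left sum_distrib_right
        using False by (intro sum.cong refl) simp
      then show ?thesis using False by simp
    qed
    moreover have "cont3 (\<lambda>x y w. \<Sum>k=1..m. (\<Sum>j | j \<in> {1..k} \<and> j dvd k.
        adj_char s j x y w * (of_nat k * of_int (letter (k div j)) / (of_nat j * of_nat m)))
          * exp_fps (\<lambda>n. adj_char s n x y w) $ (m - k))"
      by (intro cont3_sum cont3_mult cont3_const cont3_adj_char less.IH) auto
    ultimately show ?thesis by simp
  qed (simp add: exp_fps_nth_0 cont3_const)
qed

text \<open>The Weyl density in a form that can be paired with alternants; it is left unnormalised,
  with average 48.\<close>

definition haar :: "bool \<Rightarrow> complex \<Rightarrow> complex \<Rightarrow> complex \<Rightarrow> complex" where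
  "haar s x y w = alternant s 2 1 0 x y w * alternant s 2 1 0 (1 / x) (1 / y) (1 / w)"

lemma cont3_det3:
  assumes "continuous_on circ f" "continuous_on circ g" "continuous_on circ h"
  shows "cont3 (det3 f g h)"
  unfolding det3_def using assms by (intro cont3_add cont3_diff cont3_mult cont3_coord)

lemma cont3_alternant:
  "cont3 (alternant s a b c)" "cont3 (\<lambda>x y w. alternant s a b c (1 / x) (1 / y) (1 / w))"
proof -
  show "cont3 (alternant s a b c)"
    unfolding alternant_def by (intro cont3_det3 continuous_on_skew)
  show "cont3 (\<lambda>x y w. alternant s a b c (1 / x) (1 / y) (1 / w))"
    unfolding alternant_def
    using cont3_det3[OF continuous_on_skew[of s "int a", THEN continuous_on_circ_inverse]
        continuous_on_skew[of s "int b", THEN continuous_on_circ_inverse]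
        continuous_on_skew[of s "int c", THEN continuous_on_circ_inverse]]
    by (simp add: det3_def[abs_def])
qed

lemma cont3_haar: "cont3 (haar s)"
  unfolding haar_def by (intro cont3_mult cont3_alternant)

lemma cont3_bounded:
  assumes "cont3 F"
  obtains C where "\<And>x y w. \<lbrakk>x \<in> circ; y \<in> circ; w \<in> circ\<rbrakk> \<Longrightarrow> norm (F x y w) \<le> C"
proof -
  have "compact ((\<lambda>(x, y, w). F x y w) ` (circ \<times> circ \<times> circ))"
    using assms unfolding cont3_def by (intro compact_continuous_image compact_Times) auto
  then have "bounded ((\<lambda>(x, y, w). F x y w) ` (circ \<times> circ \<times> circ))"
    by (rule compact_imp_bounded)
  then obtain C where "\<And>p. p \<in> circ \<times> circ \<times> circ \<Longrightarrow> norm (case p of (x, y, w) \<Rightarrow> F x y w) \<le> C"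
    by (auto simp: bounded_iff)
  then show thesis by (intro that[of C]) force
qed

definition coeff :: "bool \<Rightarrow> nat \<Rightarrow> complex" where
  "coeff s m = avg3 (\<lambda>x y w. haar s x y w * exp_fps (\<lambda>n. adj_char s n x y w) $ m) / 48"

text \<open>Joins the prefactor, the Weyl density and termwise integration. The number 24 bounds
  both the character (21) and the character minus 3, and \<open>8 * 24\<close> is then the growth
  rate from \<open>norm_exp_fps_nth\<close>.\<close>

lemma gauge_index_sums:
  assumes t: "norm t < 1 / (8 * 24)"
    and R: "\<And>z n. \<lbrakk>z 0 \<noteq> 0; z 1 \<noteq> 0; z 2 \<noteq> 0\<rbrakk> \<Longrightarrow>
      R (\<lambda>i. z i ^ n) = adj_char s n (z 0) (z 1) (z 2) - 3"
  shows "(\<lambda>m. coeff s m * t ^ m) sums gauge_index 3 R (t ^ 2) (t ^ 3) (t ^ 3)"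
proof -
  have t1: "norm t < 1" using t by simp
  define L where "L y = suminf (\<lambda>n. y (Suc n) / of_nat (Suc n) * single_letter (t ^ Suc n))" for y
  have L: "(\<lambda>n. y (Suc n) / of_nat (Suc n) * single_letter (t ^ Suc n)) sums L y"
    if "\<And>n. norm (y n) \<le> 24" for y
    using log_fps_sums[OF t1, of y 24] that unfolding L_def by (auto simp: sums_iff)
  define E where "E x y w = exp (L (\<lambda>n. adj_char s n x y w))" for x y w
  define e where "e = exp (of_nat 3 * L (\<lambda>_. 1))"
  have roots: "norm (adj_char s n x y w - 3) \<le> 24" "norm (adj_char s n x y w) \<le> 24"
    if "x \<in> circ" "y \<in> circ" "w \<in> circ" for n x y w
    using norm_adj_char[OF that, of s n] norm_triangle_ineq4[of "adj_char s n x y w" 3] by simp_all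
  let ?z = "\<lambda>x y w. (\<lambda>_. 1)(0 := x, 1 := y, 2 := w) :: nat \<Rightarrow> complex"
  let ?PE = "PE (\<lambda>a p q z. (a - 1) / ((1 - p) * (1 - q)) * R z) (t ^ 2) (t ^ 3) (t ^ 3)"
  have PE: "e * ?PE (?z x y w) = haar s x y w * E x y w"
    if c: "x \<in> circ" "y \<in> circ" "w \<in> circ"
      and ne: "w \<notin> {1, -1}" "y \<notin> {1, -1, w, 1 / w}" "x \<notin> {1, -1, y, 1 / y, w, 1 / w}" for x y w
  proof -
    have nz: "x \<noteq> 0" "y \<noteq> 0" "w \<noteq> 0" using c by auto
    \<comment> \<open>The value -1 has to be excluded for \<open>Sp(3)\<close>, where the roots
      along the axes are squares.\<close>
    have sq: "u ^ stretch s 1 \<noteq> 1" if "u \<notin> {1, -1}" for u :: complex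
      using that by (cases s) (auto simp: power2_eq_1_iff simp flip: power2_eq_square)
    have "1 \<notin> set (nonzero_roots s x y w)"
      using ne nz sq[of x] sq[of y] sq[of w]
      by (auto simp: nonzero_roots_def field_simps)
    then have "?PE (?z x y w) = weyl_density s x y w * exp (L (\<lambda>n. adj_char s n x y w - 3))"
      using R[of "?z x y w"] nz
      by (intro PE_roots_eq[OF t1 c] L[of "\<lambda>n. adj_char s n x y w - 3"] roots c) auto
    \<comment> \<open>The rank term 3 of the character is supplied by the prefactor
      \<open>e\<close>.\<close>
    moreover have "L (\<lambda>n. adj_char s n x y w) = L (\<lambda>n. adj_char s n x y w - 3) + 3 * L (\<lambda>_. 1)"
    proof (rule sums_unique2[OF L])
      have "(\<lambda>n. (adj_char s (Suc n) x y w - 3) / of_nat (Suc n) * single_letter (t ^ Suc n)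
          + 3 * (1 / of_nat (Suc n) * single_letter (t ^ Suc n)))
          sums (L (\<lambda>n. adj_char s n x y w - 3) + 3 * L (\<lambda>_. 1))"
        using L[OF roots(1)[OF c]] L[of "\<lambda>_. 1"] by (intro sums_add sums_mult) auto
      then show "(\<lambda>n. adj_char s (Suc n) x y w / of_nat (Suc n) * single_letter (t ^ Suc n))
          sums (L (\<lambda>n. adj_char s n x y w - 3) + 3 * L (\<lambda>_. 1))"
        by (simp add: diff_divide_distrib left_diff_distrib del: of_nat_Suc power_Suc)
    qed (rule roots(2)[OF c])
    ultimately show ?thesis
      unfolding e_def E_def haar_def weyl_density_alternant[OF nz]
      by (simp add: exp_add)
  qed
  have "gauge_index 3 R (t ^ 2) (t ^ 3) (t ^ 3) = e / 48 * avg3 (\<lambda>x y w. ?PE (?z x y w))"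
    using prefactor_eq_exp[OF t1, of "L (\<lambda>_. 1)" 3] L[of "\<lambda>_. 1"]
    unfolding gauge_index_def torus_integral_3 e_def
    by (simp add: fact_numeral field_simps)
  also have "\<dots> = avg3 (\<lambda>x y w. e * ?PE (?z x y w)) / 48"
    by (simp add: avg3_cmult)
  also have "avg3 (\<lambda>x y w. e * ?PE (?z x y w)) = avg3 (\<lambda>x y w. haar s x y w * E x y w)"
    by (rule avg3_cong_generic) (rule PE)
  finally have index: "gauge_index 3 R (t ^ 2) (t ^ 3) (t ^ 3)
    = avg3 (\<lambda>x y w. haar s x y w * E x y w) / 48" .
  obtain C where C: "\<And>x y w. \<lbrakk>x \<in> circ; y \<in> circ; w \<in> circ\<rbrakk> \<Longrightarrow> norm (haar s x y w) \<le> C"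
    by (rule cont3_bounded[OF cont3_haar[of s]]) blast
  have "norm (haar s 1 1 1) \<le> C" by (rule C) auto
  then have "C \<ge> 0" by (rule order_trans[OF norm_ge_zero])
  let ?F = "\<lambda>m x y w. haar s x y w * exp_fps (\<lambda>n. adj_char s n x y w) $ m * t ^ m"
  have "(\<lambda>m. avg3 (?F m)) sums avg3 (\<lambda>x y w. haar s x y w * E x y w)"
  proof (rule avg3_sums)
    show "cont3 (?F m)" for m
      by (intro cont3_mult cont3_haar cont3_exp_fps cont3_const)
    show "summable (\<lambda>m. C * (8 * 24 * norm t) ^ m)"
      using t by (intro summable_mult summable_geometric) simp
    fix x y w assume c: "x \<in> circ" "y \<in> circ" "w \<in> circ"
    have "norm (exp_fps (\<lambda>n. adj_char s n x y w) $ m) \<le> (8 * 24) ^ m" for m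
      using roots(2)[OF c] by (intro norm_exp_fps_nth) auto
    then show "norm (?F m x y w) \<le> C * (8 * 24 * norm t) ^ m" for m
      unfolding norm_mult norm_power power_mult_distrib[of "8 * 24"] mult.assoc[symmetric]
      using C[OF c] \<open>C \<ge> 0\<close> by (intro mult_mono) auto
    have "(\<lambda>m. exp_fps (\<lambda>n. adj_char s n x y w) $ m * t ^ m) sums E x y w"
      unfolding E_def using roots(2)[OF c] t by (intro exp_fps_sums[of _ 24] L) auto
    from sums_mult[OF this, of "haar s x y w"]
    show "(\<lambda>m. ?F m x y w) sums (haar s x y w * E x y w)"
      by (simp add: mult.assoc)
  qed
  from sums_divide[OF this, of 48] have "(\<lambda>m. avg3 (?F m) / 48) sums gauge_index 3 R (t ^ 2) (t ^ 3) (t ^ 3)"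
    by (simp add: index)
  moreover have "avg3 (?F m) / 48 = coeff s m * t ^ m" for m
    using avg3_cmult[of "t ^ m" "\<lambda>x y w. haar s x y w * exp_fps (\<lambda>n. adj_char s n x y w) $ m"]
    by (simp add: coeff_def mult.commute)
  ultimately show ?thesis by simp
qed

lemma roots_power:
  assumes "z 0 \<noteq> 0" "z 1 \<noteq> 0" "z 2 \<noteq> 0"
  shows "roots_SO_odd 3 (\<lambda>i. z i ^ n) = adj_char False n (z 0) (z 1) (z 2) - 3"
    and "roots_Sp 3 (\<lambda>i. z i ^ n) = adj_char True n (z 0) (z 1) (z 2) - 3"
proof -
  have pair: "pow_sum n u * pow_sum n v
      = (u ^ n / v ^ n + v ^ n / u ^ n) + (u ^ n * v ^ n + 1 / (u ^ n * v ^ n))"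
    if "u \<noteq> 0" "v \<noteq> 0" for u v
    using that by (simp add: pow_sum_def field_simps)
  have single: "pow_sum (n + n) u = (u ^ n) ^ 2 + 1 / (u ^ n) ^ 2" for u
    by (simp add: pow_sum_def power_add power2_eq_square)
  note sum3 = numeral_3_eq_3 sum.lessThan_Suc lessThan_0 sum.empty
  show "roots_SO_odd 3 (\<lambda>i. z i ^ n) = adj_char False n (z 0) (z 1) (z 2) - 3"
    unfolding adj_char_def pair[OF assms(1,2)] pair[OF assms(1,3)] pair[OF assms(2,3)]
    by (simp add: roots_SO_odd_def sum3 numeral_2_eq_2) (simp add: pow_sum_def)
  show "roots_Sp 3 (\<lambda>i. z i ^ n) = adj_char True n (z 0) (z 1) (z 2) - 3"
    unfolding adj_char_def pair[OF assms(1,2)] pair[OF assms(1,3)] pair[OF assms(2,3)]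
    by (simp add: roots_Sp_def single sum3 numeral_2_eq_2)
qed

section \<open>Coefficients\<close>

text \<open>The indices in a table are strictly decreasing by construction, so orthogonality applies
  entry by entry and only the leading entry has a nonzero average.\<close>

lemma avg3_ev3:
  "avg3 (\<lambda>x y w. ev3 (alternant_at s x y w) 0 T * alternant s 2 1 0 (1 / x) (1 / y) (1 / w))
    = 48 * of_int (head3 T)"
proof -
  define \<Phi> :: "nat \<Rightarrow> nat \<Rightarrow> nat \<Rightarrow> complex" where "\<Phi> a b c = 48 * of_bool (a = 2 \<and> b = 1 \<and> c = 0)" for a b c
  define \<rho> where "\<rho> x y w = alternant s 2 1 0 (1 / x) (1 / y) (1 / w)" for x y w
  have contV: "cont3 (\<lambda>x y w. alternant s a b c x y w * \<rho> x y w)" for a b c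
    unfolding \<rho>_def by (intro cont3_mult cont3_alternant)
  have V: "avg3 (\<lambda>x y w. alternant s a b c x y w * \<rho> x y w) = \<Phi> a b c" if "b < a" "c < b" for a b c
    unfolding \<rho>_def \<Phi>_def using that by (rule alternant_orthogonal)
  have 1: "cont3 (\<lambda>x y w. ev1 (alternant_at s x y w) c b a l * \<rho> x y w) \<and>
      avg3 (\<lambda>x y w. ev1 (alternant_at s x y w) c b a l * \<rho> x y w) = ev1 \<Phi> c b a l"
    if "c < b" "b < a" for c b a l
    using that(2)
  proof (induction l arbitrary: a)
    case (Cons k l)
    then show ?case
      using V[OF Cons.prems that(1)] Cons.IH[of "Suc a"] contV[of a b c]
      by (simp add: ring_distribs mult.assoc avg3_add avg3_cmult cont3_add cont3_mult cont3_const)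
  qed (simp add: cont3_const avg3_const)
  have 2: "cont3 (\<lambda>x y w. ev2 (alternant_at s x y w) c b t * \<rho> x y w) \<and>
      avg3 (\<lambda>x y w. ev2 (alternant_at s x y w) c b t * \<rho> x y w) = ev2 \<Phi> c b t"
    if "c < b" for c b t
    using that
  proof (induction t arbitrary: b)
    case (Cons l t)
    then show ?case
      using 1[of c b "Suc b" l] Cons.IH[of "Suc b"]
      by (simp add: ring_distribs avg3_add cont3_add)
  qed (simp add: cont3_const avg3_const)
  have 3: "cont3 (\<lambda>x y w. ev3 (alternant_at s x y w) c T * \<rho> x y w) \<and>
      avg3 (\<lambda>x y w. ev3 (alternant_at s x y w) c T * \<rho> x y w) = ev3 \<Phi> c T" for c
  proof (induction T arbitrary: c)
    case (Cons t T)
    then show ?case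
      using 2[of c "Suc c" t]
      by (simp add: ring_distribs avg3_add cont3_add)
  qed (simp add: cont3_const avg3_const)
  have z1: "ev1 \<Phi> c b a l = 0" if "c \<noteq> 0 \<or> b \<noteq> 1 \<or> 2 < a" for c b a l
    using that by (induction l arbitrary: a) (auto simp: \<Phi>_def)
  have z2: "ev2 \<Phi> c b t = 0" if "c \<noteq> 0 \<or> 1 < b" for c b t
    using that by (induction t arbitrary: b) (auto simp: z1)
  have z3: "ev3 \<Phi> c T = 0" if "c \<noteq> 0" for c T
    using that by (induction T arbitrary: c) (auto simp: z2)
  have "\<Phi> (Suc (Suc 0)) (Suc 0) 0 = 48" by (simp add: \<Phi>_def numeral_2_eq_2)
  then have "ev3 \<Phi> 0 T = 48 * of_int (head3 T)"
    by (induction T rule: head3.induct) (auto simp: z1 z2 z3)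
  with 3[of 0] show ?thesis by (simp add: \<rho>_def)
qed

text \<open>The numbers \<open>d f_d\<close> for \<open>d\<close> from 1 to 23, enough for all
  orders below 24.\<close>

definition letter_weights :: "int list" where
  "letter_weights = map (\<lambda>d. int (Suc d) * letter (Suc d)) [0..<23]"

text \<open>Reduces the coefficients to a computation with integers. The initial table is the
  alternant of \<rho>, as \<open>P_0 = 1\<close>; the factor 48 of orthogonality cancels the one in
  \<open>coeff\<close>, and \<open>rev\<close> is due to the newest-first history.\<close>

lemma coeff_run:
  assumes "out (run s letter_weights 23 0 (True, [[[[1]]]])) = (True, hs)"
  shows "map (coeff s) [0..<24] = map of_int (rev hs)"
proof -
  obtain ok Ts where run: "run s letter_weights 23 0 (True, [[[[1]]]]) = (ok, Ts)"
    by (cases "run s letter_weights 23 0 (True, [[[[1]]]])")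
  with assms have ok: "ok = True" and hs: "hs = map head3 Ts" by auto
  have ev: "map (ev3 (alternant_at s x y w) 0) Ts
      = map (\<lambda>i. exp_fps (\<lambda>n. adj_char s n x y w) $ (23 - i) * alternant s 2 1 0 x y w) [0..<24]"
    if "x \<noteq> 0" "y \<noteq> 0" "w \<noteq> 0" for x y w
  proof -
    have "map (ev3 (alternant_at s x y w) 0) Ts
      = map (\<lambda>i. exp_fps (\<lambda>n. adj_char s n x y w) $ (0 + 23 - i) * alternant s 2 1 0 x y w)
          [0..<Suc (0 + 23)]"
    proof (rule ev3_run[OF that, where M = 23 and ks = letter_weights])
      show "of_nat m * exp_fps (\<lambda>n. adj_char s n x y w) $ m = (\<Sum>j=1..m. adj_char s j x y w
         * (\<Sum>d<length letter_weights. of_int (letter_weights ! d)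
           * (if j * Suc d \<le> m then exp_fps (\<lambda>n. adj_char s n x y w) $ (m - j * Suc d) else 0)))"
        if "m \<le> 23" for m
        unfolding exp_fps_rec[OF that]
        by (intro sum.cong refl arg_cong2[where f = "(*)"])
           (auto simp: letter_weights_def simp del: upt_Suc mult_Suc_right)
      have "ev3 (alternant_at s x y w) 0 [[[1]]] = alternant s 2 1 0 x y w"
        by (simp add: numeral_2_eq_2)
      then show "map (ev3 (alternant_at s x y w) 0) [[[[1]]]]
        = map (\<lambda>i. exp_fps (\<lambda>n. adj_char s n x y w) $ (0 - i) * alternant s 2 1 0 x y w) [0..<Suc 0]"
        by (simp add: exp_fps_nth_0 del: ev3.simps)
    qed (use run ok in simp_all)
    then show ?thesis by simp
  qed
  \<comment> \<open>Any point with nonzero coordinates would do, since the length does not depend on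
    it.\<close>
  have len: "length Ts = 24"
    using ev[of 1 1 1, THEN arg_cong[where f = length]] by simp
  have "coeff s m = of_int (head3 (Ts ! (23 - m)))" if "m < 24" for m
  proof -
    have "avg3 (\<lambda>x y w. haar s x y w * exp_fps (\<lambda>n. adj_char s n x y w) $ m)
      = avg3 (\<lambda>x y w. ev3 (alternant_at s x y w) 0 (Ts ! (23 - m))
          * alternant s 2 1 0 (1 / x) (1 / y) (1 / w))"
    proof (rule avg3_cong)
      fix x y w assume "x \<in> circ" "y \<in> circ" "w \<in> circ"
      then have "x \<noteq> 0" "y \<noteq> 0" "w \<noteq> 0" by auto
      from arg_cong[OF ev[OF this], of "\<lambda>l. l ! (23 - m)"] that len
      show "haar s x y w * exp_fps (\<lambda>n. adj_char s n x y w) $ m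
        = ev3 (alternant_at s x y w) 0 (Ts ! (23 - m)) * alternant s 2 1 0 (1 / x) (1 / y) (1 / w)"
        by (simp add: haar_def mult_ac del: upt_Suc)
    qed
    also have "\<dots> = 48 * of_int (head3 (Ts ! (23 - m)))"
      by (rule avg3_ev3)
    finally show ?thesis by (simp add: coeff_def)
  qed
  then show ?thesis
    by (intro nth_equalityI) (auto simp: hs len rev_nth simp del: upt_Suc)
qed

lemma coeff_SO7: "map (coeff False) [0..<24] = map of_int
    [1, 0, 0, 0, 1, -2, 1, 2, -2, -2, 6, -4, -5, 10, 2, -18, 15, 10, -33, 14, 40, -56, -4, 84]"
proof -
  have "out (run False letter_weights 23 0 (True, [[[[1]]]])) = (True, rev
    [1, 0, 0, 0, 1, -2, 1, 2, -2, -2, 6, -4, -5, 10, 2, -18, 15, 10, -33, 14, 40, -56, -4, 84])"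
    \<comment> \<open>Besides the coefficients, this evaluation confirms that all 23 rounds of
      divisions are exact.\<close>
    by code_simp
  from coeff_run[OF this] show ?thesis by (simp only: rev_rev_ident)
qed

lemma coeff_Sp3: "map (coeff True) [0..<24] = map of_int
    [1, 0, 0, 0, 1, -2, 1, 2, -2, -2, 6, -4, -5, 10, 2, -18, 15, 10, -33, 14, 40, -56, -5, 86]"
proof -
  have "out (run True letter_weights 23 0 (True, [[[[1]]]])) = (True, rev
    [1, 0, 0, 0, 1, -2, 1, 2, -2, -2, 6, -4, -5, 10, 2, -18, 15, 10, -33, 14, 40, -56, -5, 86])"
    by code_simp
  from coeff_run[OF this] show ?thesis by (simp only: rev_rev_ident)
qed

theorem mainTheorem8:
  shows "\<exists>F G :: complex fps.
    (\<lambda>t. index_SO_odd 3 (t ^ 2) (t ^ 3) (t ^ 3)) has_fps_expansion F \<and>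
    (\<lambda>t. index_Sp 3 (t ^ 2) (t ^ 3) (t ^ 3)) has_fps_expansion G \<and>
    map (fps_nth F) [0..<24] =
      [1, 0, 0, 0, 1, -2, 1, 2, -2, -2, 6, -4, -5, 10, 2, -18,
       15, 10, -33, 14, 40, -56, -4, 84] \<and>
    map (fps_nth G) [0..<24] =
      [1, 0, 0, 0, 1, -2, 1, 2, -2, -2, 6, -4, -5, 10, 2, -18,
       15, 10, -33, 14, 40, -56, -5, 86] \<and>
    (\<forall>n\<le>21. fps_nth F n = fps_nth G n) \<and>
    fps_nth F 22 \<noteq> fps_nth G 22"
proof (intro exI conjI)
  let ?F = "Abs_fps (coeff False)" and ?G = "Abs_fps (coeff True)"
  show "(\<lambda>t. index_SO_odd 3 (t ^ 2) (t ^ 3) (t ^ 3)) has_fps_expansion ?F"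
    unfolding index_SO_odd_def
    by (rule has_fps_expansion_if_sums[of "1 / (8 * 24)"], simp,
        rule gauge_index_sums, assumption, rule roots_power(1))
  show "(\<lambda>t. index_Sp 3 (t ^ 2) (t ^ 3) (t ^ 3)) has_fps_expansion ?G"
    unfolding index_Sp_def
    by (rule has_fps_expansion_if_sums[of "1 / (8 * 24)"], simp,
        rule gauge_index_sums, assumption, rule roots_power(2))
  have nth: "fps_nth (Abs_fps f) = f" for f :: "nat \<Rightarrow> complex"
    by (rule ext) simp
  show F: "map (fps_nth ?F) [0..<24] =
      [1, 0, 0, 0, 1, -2, 1, 2, -2, -2, 6, -4, -5, 10, 2, -18,
       15, 10, -33, 14, 40, -56, -4, 84]"
    unfolding nth coeff_SO7 by simp
  show G: "map (fps_nth ?G) [0..<24] =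
      [1, 0, 0, 0, 1, -2, 1, 2, -2, -2, 6, -4, -5, 10, 2, -18,
       15, 10, -33, 14, 40, -56, -5, 86]"
    unfolding nth coeff_Sp3 by simp
  have eq: "fps_nth H n = map (fps_nth H) [0..<24] ! n" if "n < 24" for H :: "complex fps" and n
    using that by (simp del: upt_Suc)
  \<comment> \<open>The first 22 entries are the orders 0 to 21; the lists first differ at position
    22.\<close>
  have "take 22 (map (fps_nth ?F) [0..<24]) = take 22 (map (fps_nth ?G) [0..<24])"
    unfolding F G by simp
  then have "map (fps_nth ?F) [0..<24] ! n = map (fps_nth ?G) [0..<24] ! n" if "n < 22" for n
    using that by (metis nth_take)
  then show "\<forall>n\<le>21. fps_nth ?F n = fps_nth ?G n"
    by (simp add: eq del: upt_Suc)
  show "fps_nth ?F 22 \<noteq> fps_nth ?G 22"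
    using eq[of 22 ?F] eq[of 22 ?G] unfolding F G by simp
qed

end
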